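(* Suppose that $\kappa$ is an infinite cardinal and assume $\mathsf{MA}_{\sigma\text{-linked}}(\kappa)$. Then the Banach space $\ell_\infty/c_0$ is $c_0(\kappa)$-automorphic, and so $c_0(\kappa)$-extensible.
   Context: All Banach spaces are over $\mathbb{R}$; operators are bounded and linear; $\ell_\infty=\ell_\infty(\mathbb{N})$, $c_0=c_0(\mathbb{N})$, and $\ell_\infty/c_0$ carries the quotient norm. An isomorphism is a linear homeomorphism. $dens(X)$ is the least cardinality of a dense subset of $X$. Let $X,Y$ be Banach spaces. $X$ is $Y$-extensible if for every (closed) subspace $Z\subseteq X$ isomorphic to $Y$ every operator $T:Z\to X$ extends to an operator $\tilde T:X\to X$. $X$ is $Y$-automorphic if for all subspaces $Z,Z'\subseteq X$ which are isomorphic to $Y$ and have the same codimension (i.e., $dens(X/Z)=dens(X/Z')$), every isomorphism between $Z$ and $Z'$ extends to an automorphism of $X$ (an isomorphism of $X$ onto $X$). A partial order $\mathbb{P}$ is $\sigma$-linked if $\mathbb{P}=\bigcup_{n\in\mathbb{N}}\mathbb{P}_n$ where each $\mathbb{P}_n$ is linked, i.e., any two elements of $\mathbb{P}_n$ are compatible in $\mathbb{P}$ (have a common lower bound in $\mathbb{P}$). $\mathsf{MA}_{\sigma\text{-linked}}(\kappa)$ is the statement: for every $\sigma$-linked partial order $\mathbb{P}$ and every family $\mathcal{D}$ of cardinality $\kappa$ of dense subsets of $\mathbb{P}$ there is a filter $\mathbb{G}\subseteq\mathbb{P}$ such that $\mathbb{G}\cap\mathbb{D}\neq\emptyset$ for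 every $\mathbb{D}\in\mathcal{D}$. *)

theory Defs
  imports "HOL-Analysis.Analysis"
begin

unbundle cardinal_syntax
no_notation elt_set_eq (infix \<open>=o\<close> 50)

section \<open>The Banach space \<open>c\<^sub>0(\<kappa>)\<close>\<close>

text \<open>The cardinal \<open>\<kappa>\<close> is represented by an index type \<open>'k\<close> of that cardinality.\<close>

typedef 'k c0 = "{f :: 'k \<Rightarrow> real. \<forall>e>0. finite {i. e \<le> \<bar>f i\<bar>}}"
  morphisms c0_apply Abs_c0
  by (rule exI[of _ "\<lambda>_. 0"]) auto

setup_lifting type_definition_c0

lemma c0_bdd: assumes "\<forall>e>0. finite {i. e \<le> \<bar>f i :: real\<bar>}" shows "bdd_above (range (\<lambda>i. \<bar>f i\<bar>))"
proof -
  have "finite {i. 1 \<le> \<bar>f i\<bar>}" using assms by (auto dest: spec[of _ 1])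
  then have "finite ((\<lambda>i. \<bar>f i\<bar>) ` {i. 1 \<le> \<bar>f i\<bar>})" by simp
  then have "bdd_above ({..1} \<union> (\<lambda>i. \<bar>f i\<bar>) ` {i. 1 \<le> \<bar>f i\<bar>})"
    by (simp add: bdd_above_finite)
  then show ?thesis by (rule bdd_above_mono) force
qed

instantiation c0 :: (type) real_normed_vector
begin

lift_definition zero_c0 :: "'a c0" is "\<lambda>_. 0" by simp

lift_definition plus_c0 :: "'a c0 \<Rightarrow> 'a c0 \<Rightarrow> 'a c0" is "\<lambda>f g i. f i + g i"
proof -
  fix f g :: "'a \<Rightarrow> real" and e :: real
  assume f: "\<And>e. 0 < e \<Longrightarrow> finite {i. e \<le> \<bar>f i\<bar>}"
    and g: "\<And>e. 0 < e \<Longrightarrow> finite {i. e \<le> \<bar>g i\<bar>}" and "0 < e"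
  have "finite ({i. e/2 \<le> \<bar>f i\<bar>} \<union> {i. e/2 \<le> \<bar>g i\<bar>})"
    by (intro finite_UnI f g) (use \<open>0 < e\<close> in simp_all)
  then show "finite {i. e \<le> \<bar>f i + g i\<bar>}" by (rule rev_finite_subset) auto
qed

lift_definition uminus_c0 :: "'a c0 \<Rightarrow> 'a c0" is "\<lambda>f i. - f i" by simp

definition minus_c0 :: "'a c0 \<Rightarrow> 'a c0 \<Rightarrow> 'a c0" where "minus_c0 f g = f + (- g)"

lift_definition scaleR_c0 :: "real \<Rightarrow> 'a c0 \<Rightarrow> 'a c0" is "\<lambda>r f i. r * f i"
proof -
  fix r :: real and f :: "'a \<Rightarrow> real" and e :: real
  assume f: "\<And>e. 0 < e \<Longrightarrow> finite {i. e \<le> \<bar>f i\<bar>}" and e: "0 < e"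
  show "finite {i. e \<le> \<bar>r * f i\<bar>}"
  proof (cases "r = 0")
    case True then show ?thesis using e by simp
  next
    case False
    then have "{i. e \<le> \<bar>r * f i\<bar>} = {i. e / \<bar>r\<bar> \<le> \<bar>f i\<bar>}"
      by (auto simp: field_simps abs_mult)
    then show ?thesis using f e False by simp
  qed
qed

lift_definition norm_c0 :: "'a c0 \<Rightarrow> real" is "\<lambda>f. SUP i. \<bar>f i\<bar>" .

definition dist_c0 :: "'a c0 \<Rightarrow> 'a c0 \<Rightarrow> real" where "dist_c0 f g = norm (f - g)"
definition sgn_c0 :: "'a c0 \<Rightarrow> 'a c0" where "sgn_c0 f = scaleR (inverse (norm f)) f"
definition uniformity_c0 :: "('a c0 \<times> 'a c0) filter"
  where "uniformity_c0 = (INF e\<in>{0<..}. principal {(x, y). dist x y < e})"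
definition open_c0 :: "'a c0 set \<Rightarrow> bool"
  where "open_c0 U = (\<forall>x\<in>U. eventually (\<lambda>(x', y). x' = x \<longrightarrow> y \<in> U) uniformity)"

lemma c0_apply_minus: "c0_apply (f - g) i = c0_apply f i - c0_apply g i"
  by (simp add: minus_c0_def plus_c0.rep_eq uminus_c0.rep_eq)

lemma c0_abs_le_norm: "\<bar>c0_apply f i\<bar> \<le> norm f"
  by transfer (rule cSUP_upper[OF _ c0_bdd], auto)

lemma c0_norm_le: "(\<And>i. \<bar>c0_apply f i\<bar> \<le> b) \<Longrightarrow> norm f \<le> b"
  by transfer (rule cSUP_least, auto)

instance
proof
  fix a b :: real and x y z :: "'a c0"
  show "x + y + z = x + (y + z)" by transfer (simp add: add.assoc)
  show "x + y = y + x" by transfer (simp add: add.commute)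
  show "0 + x = x" by transfer simp
  show "- x + x = 0" by transfer simp
  show "x - y = x + - y" by (rule minus_c0_def)
  show "a *\<^sub>R (x + y) = a *\<^sub>R x + a *\<^sub>R y" by transfer (simp add: algebra_simps)
  show "(a + b) *\<^sub>R x = a *\<^sub>R x + b *\<^sub>R x" by transfer (simp add: algebra_simps)
  show "a *\<^sub>R b *\<^sub>R x = (a * b) *\<^sub>R x" by transfer (simp add: algebra_simps)
  show "1 *\<^sub>R x = x" by transfer simp
  show "dist x y = norm (x - y)" by (rule dist_c0_def)
  show "sgn x = scaleR (inverse (norm x)) x" by (rule sgn_c0_def)
  show "uniformity = (INF e\<in>{0<..}. principal {(x :: 'a c0, y). dist x y < e})"
    by (rule uniformity_c0_def)
  show "open U = (\<forall>x\<in>U. \<forall>\<^sub>F (x', y) in uniformity. x' = x \<longrightarrow> y \<in> U)" for U :: "'a c0 set"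
    by (rule open_c0_def)
  show "(norm x = 0) = (x = 0)"
  proof
    assume "norm x = 0"
    then have "c0_apply x i = 0" for i using c0_abs_le_norm[of x i] by simp
    then show "x = 0" by (simp add: c0_apply_inject[symmetric] zero_c0.rep_eq fun_eq_iff)
  next
    assume "x = 0" then show "norm x = 0" by transfer simp
  qed
  show "norm (x + y) \<le> norm x + norm y"
  proof (rule c0_norm_le)
    fix i
    show "\<bar>c0_apply (x + y) i\<bar> \<le> norm x + norm y"
      using c0_abs_le_norm[of x i] c0_abs_le_norm[of y i] by (simp add: plus_c0.rep_eq)
  qed
  have le: "norm (r *\<^sub>R w) \<le> \<bar>r\<bar> * norm w" for r and w :: "'a c0"
    by (rule c0_norm_le) (simp add: scaleR_c0.rep_eq abs_mult c0_abs_le_norm mult_left_mono)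
  have sc: "inverse a *\<^sub>R a *\<^sub>R x = x" if "a \<noteq> 0" using that by transfer (simp add: fun_eq_iff)
  show "norm (a *\<^sub>R x) = \<bar>a\<bar> * norm x"
  proof (cases "a = 0")
    case True
    then show ?thesis by transfer simp
  next
    case False
    have "norm x \<le> \<bar>inverse a\<bar> * norm (a *\<^sub>R x)" using le[of "inverse a" "a *\<^sub>R x"] sc[OF False] by simp
    then have "\<bar>a\<bar> * norm x \<le> norm (a *\<^sub>R x)" using False by (simp add: field_simps)
    then show ?thesis using le[of a x] by simp
  qed
qed

end

instance c0 :: (type) banach
proof
  fix X :: "nat \<Rightarrow> 'a c0"
  assume X: "Cauchy X"
  have d: "\<bar>c0_apply (X m) i - c0_apply (X n) i\<bar> \<le> dist (X m) (X n)" for m n i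
    using c0_abs_le_norm[of "X m - X n" i] by (simp add: c0_apply_minus dist_norm)
  have "Cauchy (\<lambda>n. c0_apply (X n) i)" for i
    using X d unfolding Cauchy_def dist_real_def by (meson le_less_trans)
  then have "convergent (\<lambda>n. c0_apply (X n) i)" for i by (simp add: real_Cauchy_convergent)
  then obtain l where l: "\<And>i. (\<lambda>n. c0_apply (X n) i) \<longlonglongrightarrow> l i" unfolding convergent_def by metis
  have unif: "\<exists>M. \<forall>n\<ge>M. \<forall>i. \<bar>c0_apply (X n) i - l i\<bar> \<le> e" if "e > 0" for e
  proof -
    obtain M where M: "\<And>m n. m \<ge> M \<Longrightarrow> n \<ge> M \<Longrightarrow> dist (X m) (X n) < e"
      using X \<open>e > 0\<close> unfolding Cauchy_def by metis
    have "\<bar>c0_apply (X n) i - l i\<bar> \<le> e" if "n \<ge> M" for n i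
    proof (rule Lim_bounded)
      show "(\<lambda>m. \<bar>c0_apply (X n) i - c0_apply (X m) i\<bar>) \<longlonglongrightarrow> \<bar>c0_apply (X n) i - l i\<bar>"
        by (intro tendsto_intros l)
      show "\<forall>m\<ge>M. \<bar>c0_apply (X n) i - c0_apply (X m) i\<bar> \<le> e"
        using M[OF that] d[of n i] by (meson le_less_trans less_imp_le)
    qed
    then show ?thesis by blast
  qed
  have "\<forall>e>0. finite {i. e \<le> \<bar>l i\<bar>}"
  proof (intro allI impI)
    fix e :: real assume "e > 0"
    then obtain M where M: "\<And>i. \<bar>c0_apply (X M) i - l i\<bar> \<le> e/2" using unif[of "e/2"] by auto
    have "finite {i. e/2 \<le> \<bar>c0_apply (X M) i\<bar>}" using c0_apply[of "X M"] half_gt_zero[OF \<open>e > 0\<close>] by blast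
    moreover have "{i. e \<le> \<bar>l i\<bar>} \<subseteq> {i. e/2 \<le> \<bar>c0_apply (X M) i\<bar>}"
    proof
      fix i assume "i \<in> {i. e \<le> \<bar>l i\<bar>}"
      then show "i \<in> {i. e/2 \<le> \<bar>c0_apply (X M) i\<bar>}" using M[of i] by (auto simp: abs_if split: if_splits)
    qed
    ultimately show "finite {i. e \<le> \<bar>l i\<bar>}" by (rule rev_finite_subset)
  qed
  then have L: "c0_apply (Abs_c0 l) = l" by (simp add: Abs_c0_inverse)
  have "X \<longlonglongrightarrow> Abs_c0 l"
  proof (rule metric_LIMSEQ_I)
    fix e :: real assume "e > 0"
    then obtain M where M: "\<And>n i. n \<ge> M \<Longrightarrow> \<bar>c0_apply (X n) i - l i\<bar> \<le> e/2" using unif[of "e/2"] by auto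
    have "norm (X n - Abs_c0 l) \<le> e/2" if "n \<ge> M" for n
      by (rule c0_norm_le) (use M[OF that] in \<open>simp add: c0_apply_minus L\<close>)
    then show "\<exists>M. \<forall>n\<ge>M. dist (X n) (Abs_c0 l) < e"
      using \<open>e > 0\<close> by (intro exI[of _ M]) (fastforce simp: dist_norm)
  qed
  then show "convergent X" by (rule convergentI)
qed


section \<open>The Banach space \<open>\<ell>\<^sub>\<infinity>/c\<^sub>0\<close>\<close>

text \<open>As \<^typ>\<open>nat\<close> is discrete, \<^typ>\<open>nat \<Rightarrow>\<^sub>C real\<close> is the space \<open>\<ell>\<^sub>\<infinity>\<close> of all bounded real sequences
  with the supremum norm.\<close>

type_synonym linf = "nat \<Rightarrow>\<^sub>C real"

lemma Cauchy_linf_convergent: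
  fixes f :: "nat \<Rightarrow> linf"
  assumes "Cauchy f" shows "convergent f"
proof -
  obtain g where "uniform_limit UNIV (\<lambda>n. apply_bcontfun (f n)) g sequentially"
    using assms uniformly_convergent_eq_cauchy[of "\<lambda>_. True" "\<lambda>n. apply_bcontfun (f n)"]
    unfolding Cauchy_def uniform_limit_sequentially_iff by (metis dist_fun_lt_imp_dist_val_lt)
  from uniform_limit_bcontfunE[OF this sequentially_bot] show ?thesis by (metis convergentI)
qed

definition null_seqs :: "linf set"
  where "null_seqs = {f. apply_bcontfun f \<longlonglongrightarrow> 0}"

lemma subspace_null_seqs: "subspace null_seqs"
  unfolding subspace_def null_seqs_def
  by (auto intro!: tendsto_eq_intros simp: zero_bcontfun.rep_eq[abs_def] plus_bcontfun.rep_eq[abs_def]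
      scaleR_bcontfun.rep_eq[abs_def])

lemma closed_null_seqs: "closed null_seqs"
  unfolding closed_sequential_limits
proof (intro allI impI, elim conjE)
  fix X and l :: linf
  assume X: "\<forall>n. X n \<in> null_seqs" and l: "X \<longlonglongrightarrow> l"
  have "apply_bcontfun l \<longlonglongrightarrow> 0"
  proof (rule LIMSEQ_I)
    fix e :: real assume e: "0 < e"
    then obtain N where "dist (X N) l < e/2" using metric_LIMSEQ_D[OF l, of "e/2"] by auto
    moreover obtain M where M: "\<And>n. n \<ge> M \<Longrightarrow> \<bar>X N n\<bar> < e/2"
      using X e LIMSEQ_D[of "apply_bcontfun (X N)" 0 "e/2"] by (auto simp: null_seqs_def)
    moreover have "\<bar>X N n - l n\<bar> \<le> dist (X N) l" for n
      using dist_bounded[of "X N" n l] by (simp add: dist_real_def)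
    ultimately have "\<bar>l n\<bar> < e" if "n \<ge> M" for n
      using M[OF that] by (smt (verit, ccfv_SIG) field_sum_of_halves)
    then show "\<exists>M. \<forall>n\<ge>M. norm (l n - 0) < e" by auto
  qed
  then show "l \<in> null_seqs" by (simp add: null_seqs_def)
qed

quotient_type linf_mod_c0 = linf / "\<lambda>f g. f - g \<in> null_seqs"
proof (rule equivpI)
  show "reflp (\<lambda>f g :: linf. f - g \<in> null_seqs)"
    by (simp add: reflp_def subspace_0[OF subspace_null_seqs])
  show "symp (\<lambda>f g :: linf. f - g \<in> null_seqs)"
    by (rule sympI) (metis minus_diff_eq subspace_neg[OF subspace_null_seqs])
  show "transp (\<lambda>f g :: linf. f - g \<in> null_seqs)"
  proof (rule transpI)
    fix f g h :: linf assume "f - g \<in> null_seqs" "g - h \<in> null_seqs"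
    then have "(f - g) + (g - h) \<in> null_seqs" by (rule subspace_add[OF subspace_null_seqs])
    then show "f - h \<in> null_seqs" by simp
  qed
qed

lemma linf_mod_c0_class: obtains f where "x = abs_linf_mod_c0 f"
  by (induction x rule: linf_mod_c0.abs_induct) blast

instantiation linf_mod_c0 :: real_normed_vector
begin

lift_definition zero_linf_mod_c0 :: linf_mod_c0 is 0 .

lift_definition plus_linf_mod_c0 :: "linf_mod_c0 \<Rightarrow> linf_mod_c0 \<Rightarrow> linf_mod_c0" is "(+)"
proof -
  fix f f' g g' :: linf assume "f - f' \<in> null_seqs" "g - g' \<in> null_seqs"
  then have "(f - f') + (g - g') \<in> null_seqs" by (rule subspace_add[OF subspace_null_seqs])
  then show "f + g - (f' + g') \<in> null_seqs" by (simp add: algebra_simps)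
qed

lift_definition minus_linf_mod_c0 :: "linf_mod_c0 \<Rightarrow> linf_mod_c0 \<Rightarrow> linf_mod_c0" is "(-)"
proof -
  fix f f' g g' :: linf assume "f - f' \<in> null_seqs" "g - g' \<in> null_seqs"
  then have "(f - f') - (g - g') \<in> null_seqs" by (rule subspace_diff[OF subspace_null_seqs])
  then show "f - g - (f' - g') \<in> null_seqs" by (simp add: algebra_simps)
qed

lift_definition uminus_linf_mod_c0 :: "linf_mod_c0 \<Rightarrow> linf_mod_c0" is uminus
proof -
  fix f f' :: linf assume "f - f' \<in> null_seqs"
  then have "- (f - f') \<in> null_seqs" by (rule subspace_neg[OF subspace_null_seqs])
  then show "- f - - f' \<in> null_seqs" by (simp add: algebra_simps)
qed

lift_definition scaleR_linf_mod_c0 :: "real \<Rightarrow> linf_mod_c0 \<Rightarrow> linf_mod_c0" is scaleR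
proof -
  fix c and f f' :: linf assume "f - f' \<in> null_seqs"
  then have "c *\<^sub>R (f - f') \<in> null_seqs" by (rule subspace_scale[OF subspace_null_seqs])
  then show "c *\<^sub>R f - c *\<^sub>R f' \<in> null_seqs" by (simp add: algebra_simps)
qed

lift_definition norm_linf_mod_c0 :: "linf_mod_c0 \<Rightarrow> real" is "\<lambda>f. INF g\<in>{g. f - g \<in> null_seqs}. norm g"
proof -
  fix f f' :: linf assume a: "f - f' \<in> null_seqs"
  have "f - g \<in> null_seqs \<longleftrightarrow> f' - g \<in> null_seqs" for g
    using subspace_diff[OF subspace_null_seqs _ a, of "f - g"]
      subspace_add[OF subspace_null_seqs _ a, of "f' - g"] by auto
  then show "(INF g\<in>{g. f - g \<in> null_seqs}. norm g) = (INF g\<in>{g. f' - g \<in> null_seqs}. norm g)" by simp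
qed

definition dist_linf_mod_c0 :: "linf_mod_c0 \<Rightarrow> linf_mod_c0 \<Rightarrow> real"
  where "dist_linf_mod_c0 x y = norm (x - y)"
definition sgn_linf_mod_c0 :: "linf_mod_c0 \<Rightarrow> linf_mod_c0"
  where "sgn_linf_mod_c0 x = scaleR (inverse (norm x)) x"
definition uniformity_linf_mod_c0 :: "(linf_mod_c0 \<times> linf_mod_c0) filter"
  where "uniformity_linf_mod_c0 = (INF e\<in>{0<..}. principal {(x, y). dist x y < e})"
definition open_linf_mod_c0 :: "linf_mod_c0 set \<Rightarrow> bool"
  where "open_linf_mod_c0 U = (\<forall>x\<in>U. eventually (\<lambda>(x', y). x' = x \<longrightarrow> y \<in> U) uniformity)"

lemma norm_class_le: "norm (abs_linf_mod_c0 f) \<le> norm f"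
  unfolding norm_linf_mod_c0.abs_eq
  by (rule cINF_lower) (auto intro!: bdd_belowI[of _ 0] simp: subspace_0[OF subspace_null_seqs])

lemma norm_class_less:
  assumes "norm x < e" obtains f where "abs_linf_mod_c0 f = x" "norm f < e"
proof -
  obtain f0 where f0: "x = abs_linf_mod_c0 f0" by (rule linf_mod_c0_class)
  have "(INF g\<in>{g. f0 - g \<in> null_seqs}. norm g) < e" using assms by (simp add: f0 norm_linf_mod_c0.abs_eq)
  moreover have ne: "{g. f0 - g \<in> null_seqs} \<noteq> {}"
    using subspace_0[OF subspace_null_seqs] by (auto intro: exI[of _ f0])
  moreover have "bdd_below (norm ` {g. f0 - g \<in> null_seqs})" by (auto intro!: bdd_belowI[of _ 0])
  ultimately obtain g where "f0 - g \<in> null_seqs" "norm g < e"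
    by (auto simp: cINF_less_iff)
  moreover have "abs_linf_mod_c0 g = x"
    using \<open>f0 - g \<in> null_seqs\<close> unfolding f0 by (metis linf_mod_c0.abs_eq_iff)
  ultimately show thesis using that by blast
qed

lemma norm_class_nonneg: "0 \<le> norm (x :: linf_mod_c0)"
  by (metis norm_class_less norm_ge_zero not_le order_less_trans)

instance
proof
  fix a b :: real and x y z :: linf_mod_c0
  have n0: "0 \<in> null_seqs" by (rule subspace_0[OF subspace_null_seqs])
  show "x + y + z = x + (y + z)" by transfer (simp add: algebra_simps n0)
  show "x + y = y + x" by transfer (simp add: algebra_simps n0)
  show "0 + x = x" by transfer (simp add: n0)
  show "- x + x = 0" by transfer (simp add: n0)
  show "x - y = x + - y" by transfer (simp add: n0)
  show "a *\<^sub>R (x + y) = a *\<^sub>R x + a *\<^sub>R y" by transfer (simp add: algebra_simps n0)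
  show "(a + b) *\<^sub>R x = a *\<^sub>R x + b *\<^sub>R x" by transfer (simp add: algebra_simps n0)
  show ss: "a *\<^sub>R b *\<^sub>R x = (a * b) *\<^sub>R x" for a b and x :: linf_mod_c0 by transfer (simp add: algebra_simps n0)
  show s1: "1 *\<^sub>R x = x" for x :: linf_mod_c0 by transfer (simp add: n0)
  show "dist x y = norm (x - y)" by (rule dist_linf_mod_c0_def)
  show "sgn x = scaleR (inverse (norm x)) x" by (rule sgn_linf_mod_c0_def)
  show "uniformity = (INF e\<in>{0<..}. principal {(x :: linf_mod_c0, y). dist x y < e})"
    by (rule uniformity_linf_mod_c0_def)
  show "open U = (\<forall>x\<in>U. \<forall>\<^sub>F (x', y) in uniformity. x' = x \<longrightarrow> y \<in> U)" for U :: "linf_mod_c0 set"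
    by (rule open_linf_mod_c0_def)
  show nz: "(norm x = 0) = (x = 0)" for x :: linf_mod_c0
  proof
    assume nx: "norm x = 0"
    obtain f0 where f0: "x = abs_linf_mod_c0 f0" by (rule linf_mod_c0_class)
    have "f0 \<in> closure null_seqs"
      unfolding closure_approachable
    proof (intro allI impI)
      fix e :: real assume "e > 0"
      then obtain f where f: "abs_linf_mod_c0 f = x" "norm f < e" using norm_class_less[of x e] nx by auto
      then have "f0 - f \<in> null_seqs" unfolding f0 by (metis linf_mod_c0.abs_eq_iff)
      moreover have "dist (f0 - f) f0 < e" using f by (simp add: dist_norm)
      ultimately show "\<exists>y\<in>null_seqs. dist y f0 < e" by blast
    qed
    then have "f0 - 0 \<in> null_seqs" using closed_null_seqs by simp
    then show "x = 0" unfolding f0 zero_linf_mod_c0_def by (metis linf_mod_c0.abs_eq_iff)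
  next
    assume "x = 0"
    then show "norm x = 0"
      using norm_class_le[of 0] norm_class_nonneg[of x] by (simp add: zero_linf_mod_c0_def)
  qed
  show "norm (x + y) \<le> norm x + norm y"
  proof (rule field_le_epsilon)
    fix e :: real assume e: "e > 0"
    obtain f where f: "abs_linf_mod_c0 f = x" "norm f < norm x + e/2"
      using norm_class_less[of x "norm x + e/2"] e by auto
    obtain g where g: "abs_linf_mod_c0 g = y" "norm g < norm y + e/2"
      using norm_class_less[of y "norm y + e/2"] e by auto
    have "norm (x + y) \<le> norm (f + g)"
      using norm_class_le[of "f + g"] f g by (simp flip: plus_linf_mod_c0.abs_eq)
    also have "\<dots> \<le> norm f + norm g" by (rule norm_triangle_ineq)
    finally show "norm (x + y) \<le> norm x + norm y + e" using f g by simp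
  qed
  have le: "norm (r *\<^sub>R w) \<le> \<bar>r\<bar> * norm w" if r: "r \<noteq> 0" for r and w :: linf_mod_c0
  proof (rule field_le_epsilon)
    fix e :: real assume e: "e > 0"
    obtain f where f: "abs_linf_mod_c0 f = w" "norm f < norm w + e / \<bar>r\<bar>"
    proof (rule norm_class_less)
      show "norm w < norm w + e / \<bar>r\<bar>" using e r by simp
    qed
    have "norm (r *\<^sub>R w) \<le> norm (r *\<^sub>R f)"
      using norm_class_le[of "r *\<^sub>R f"] f by (simp flip: scaleR_linf_mod_c0.abs_eq)
    also have "\<dots> = \<bar>r\<bar> * norm f" by simp
    also have "\<dots> \<le> \<bar>r\<bar> * (norm w + e / \<bar>r\<bar>)" using f by (intro mult_left_mono) auto
    also have "\<dots> = \<bar>r\<bar> * norm w + e" using that by (simp add: field_simps)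
    finally show "norm (r *\<^sub>R w) \<le> \<bar>r\<bar> * norm w + e" .
  qed
  show "norm (a *\<^sub>R x) = \<bar>a\<bar> * norm x"
  proof (cases "a = 0")
    case True
    moreover have "0 *\<^sub>R x = 0" by transfer (simp add: n0)
    ultimately show ?thesis using nz by simp
  next
    case False
    have "norm x \<le> \<bar>inverse a\<bar> * norm (a *\<^sub>R x)"
      using le[of "inverse a" "a *\<^sub>R x"] False by (simp add: ss s1)
    then have "\<bar>a\<bar> * norm x \<le> norm (a *\<^sub>R x)" using False by (simp add: field_simps)
    then show ?thesis using le[OF False, of x] by simp
  qed
qed

end

lemma bounded_linear_abs_linf_mod_c0: "bounded_linear abs_linf_mod_c0"
  by (rule bounded_linear_intro[of _ 1])
    (auto simp: plus_linf_mod_c0.abs_eq scaleR_linf_mod_c0.abs_eq norm_class_le)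

instance linf_mod_c0 :: banach
proof
  fix X :: "nat \<Rightarrow> linf_mod_c0"
  assume X: "Cauchy X"
  show "convergent X"
  proof -
    have "\<exists>N. \<forall>m\<ge>N. \<forall>n\<ge>N. dist (X m) (X n) < (1/2)^k" for k
      using X unfolding Cauchy_def by simp
    then obtain N where N: "\<And>k m n. m \<ge> N k \<Longrightarrow> n \<ge> N k \<Longrightarrow> dist (X m) (X n) < (1/2)^k"
      by metis
    define s where "s k = k + (\<Sum>j\<le>k. N j)" for k
    have sN: "s k \<ge> N k" for k unfolding s_def by (simp add: trans_le_add2 sum.atMost_Suc member_le_sum)
    have s: "strict_mono s" unfolding strict_mono_Suc_iff s_def by simp
    have "norm (X (s (Suc k)) - X (s k)) < (1/2)^k" for k
      using N[of k "s (Suc k)" "s k"] sN[of k] strict_monoD[OF s, of k "Suc k"] by (simp add: dist_norm)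
    then have "\<exists>f. abs_linf_mod_c0 f = X (s (Suc k)) - X (s k) \<and> norm f < (1/2)^k" for k
      using norm_class_less by metis
    then obtain y where y: "\<And>k. abs_linf_mod_c0 (y k) = X (s (Suc k)) - X (s k)"
      and ny: "\<And>k. norm (y k) < (1/2)^k" by metis
    obtain f0 where f0: "X (s 0) = abs_linf_mod_c0 f0" by (rule linf_mod_c0_class)
    define S where "S n = f0 + (\<Sum>k<n. y k)" for n
    have dS: "dist (S m) (S n) \<le> 2 * (1/2)^m" if "m \<le> n" for m n
    proof -
      have "S n - S m = (\<Sum>k=m..<n. y k)"
        using that by (simp add: S_def sum_diff_nat_ivl lessThan_atLeast0)
      then have "norm (S n - S m) \<le> (\<Sum>k=m..<n. norm (y k))" by (simp add: norm_sum)
      also have "\<dots> \<le> (\<Sum>k=m..<n. (1/2)^k)" by (intro sum_mono less_imp_le ny)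
      also have "\<dots> = 2 * (1/2)^m - 2 * (1/2)^n"
        using that by (induction rule: dec_induct) simp_all
      also have "\<dots> \<le> 2 * (1/2)^m" by simp
      finally show ?thesis by (simp add: dist_norm norm_minus_commute)
    qed
    have "Cauchy S"
    proof (rule metric_CauchyI)
      fix e :: real assume "e > 0"
      then obtain M where M: "(1/2)^M < e/4" using real_arch_pow_inv[of "e/4" "1/2"] by auto
      have "dist (S m) (S n) < e" if "m \<ge> M" "n \<ge> M" for m n
      proof -
        have "dist (S m) (S n) \<le> dist (S M) (S m) + dist (S M) (S n)" by (rule dist_triangle3)
        also have "\<dots> \<le> 2 * (1/2)^M + 2 * (1/2)^M" using dS that by (intro add_mono) auto
        finally show ?thesis using M by simp
      qed
      then show "\<exists>M. \<forall>m\<ge>M. \<forall>n\<ge>M. dist (S m) (S n) < e" by blast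
    qed
    then obtain f where "S \<longlonglongrightarrow> f" using Cauchy_linf_convergent[of S] unfolding convergent_def by blast
    then have "(\<lambda>n. abs_linf_mod_c0 (S n)) \<longlonglongrightarrow> abs_linf_mod_c0 f"
      by (rule bounded_linear.tendsto[OF bounded_linear_abs_linf_mod_c0])
    moreover have "abs_linf_mod_c0 (S n) = X (s n)" for n
    proof (induction n)
      case 0 then show ?case by (simp add: S_def f0)
    next
      case (Suc n)
      have "S (Suc n) = S n + y n" by (simp add: S_def)
      then show ?case using Suc y[of n] by (simp flip: plus_linf_mod_c0.abs_eq)
    qed
    ultimately have "(X \<circ> s) \<longlonglongrightarrow> abs_linf_mod_c0 f" by (simp add: o_def)
    then have "X \<longlonglongrightarrow> abs_linf_mod_c0 f" by (rule Cauchy_converges_subseq[OF X s])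
    then show ?thesis by (rule convergentI)
  qed
qed


section \<open>Operators and isomorphisms between subspaces\<close>

text \<open>An operator defined on a subspace \<open>Z\<close> is a total function of which only the values on \<open>Z\<close> matter.\<close>

definition linear_on :: "'a::real_vector set \<Rightarrow> ('a \<Rightarrow> 'b::real_vector) \<Rightarrow> bool"
  where "linear_on Z T \<longleftrightarrow>
    (\<forall>x\<in>Z. \<forall>y\<in>Z. T (x + y) = T x + T y) \<and> (\<forall>c. \<forall>x\<in>Z. T (c *\<^sub>R x) = c *\<^sub>R T x)"

definition operator_on :: "'a::real_normed_vector set \<Rightarrow> ('a \<Rightarrow> 'b::real_normed_vector) \<Rightarrow> bool"
  where "operator_on Z T \<longleftrightarrow> linear_on Z T \<and> (\<exists>C. \<forall>x\<in>Z. norm (T x) \<le> C * norm x)"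

lemma operator_on_UNIV: "operator_on UNIV T \<longleftrightarrow> bounded_linear T"
  by (auto simp: operator_on_def linear_on_def bounded_linear_def bounded_linear_axioms_def
      linear_iff mult.commute)

definition isomorphism_on ::
    "'a::real_normed_vector set \<Rightarrow> 'b::real_normed_vector set \<Rightarrow> ('a \<Rightarrow> 'b) \<Rightarrow> bool"
  where "isomorphism_on Z W T \<longleftrightarrow> linear_on Z T \<and> (\<exists>S. homeomorphism Z W T S)"

definition isomorphic_to :: "'x::real_normed_vector set \<Rightarrow> 'y::real_normed_vector itself \<Rightarrow> bool"
  where "isomorphic_to Z Y \<longleftrightarrow> (\<exists>T :: 'y \<Rightarrow> 'x. isomorphism_on UNIV Z T)"


section \<open>Density character and quotients\<close>

definition dense_in :: "'a topology \<Rightarrow> 'a set \<Rightarrow> bool"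
  where "dense_in X D \<longleftrightarrow> D \<subseteq> topspace X \<and> X closure_of D = topspace X"

definition dens :: "'a topology \<Rightarrow> 'a rel"
  where "dens X = |SOME D. dense_in X D \<and> (\<forall>E. dense_in X E \<longrightarrow> |D| \<le>o |E| )|"

lemma dens_least:
  obtains D where "dense_in X D" "dens X = |D|" "\<And>E. dense_in X E \<Longrightarrow> |D| \<le>o |E|"
proof -
  have "dense_in X (topspace X)" by (simp add: dense_in_def)
  then have "\<exists>r\<in>{|D| |D. dense_in X D}. \<forall>r'\<in>{|D| |D. dense_in X D}. r \<le>o r'"
    by (intro exists_minim_Card_order) (auto simp: card_of_Card_order)
  then have "\<exists>D. dense_in X D \<and> (\<forall>E. dense_in X E \<longrightarrow> |D| \<le>o |E| )" by auto
  from someI_ex[OF this] show thesis using that unfolding dens_def by blast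
qed

definition cosets :: "'a::real_vector set \<Rightarrow> 'a set set"
  where "cosets Z = range (\<lambda>x. (+) x ` Z)"

text \<open>The quotient norm of \<open>(x + Z) - (y + Z)\<close> is the infimum of the norms of the elements of
  \<open>x - y + Z\<close>, i.e. \<^const>\<open>setdist\<close> of the two cosets.\<close>

definition quotient_top :: "'a::real_normed_vector set \<Rightarrow> 'a set topology"
  where "quotient_top Z = Metric_space.mtopology (cosets Z) setdist"

lemma setdist_cosets:
  fixes Z :: "'a::real_normed_vector set"
  assumes "subspace Z"
  shows "setdist ((+) x ` Z) ((+) y ` Z) = (INF w\<in>(+) (x - y) ` Z. norm w)"
proof -
  have "{dist u v |u v. u \<in> (+) x ` Z \<and> v \<in> (+) y ` Z} = norm ` (+) (x - y) ` Z"
  proof (intro equalityI subsetI)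
    fix d assume "d \<in> {dist u v |u v. u \<in> (+) x ` Z \<and> v \<in> (+) y ` Z}"
    then obtain z z' where z: "z \<in> Z" "z' \<in> Z" "d = dist (x + z) (y + z')" by auto
    then have "d = norm ((x - y) + (z - z'))" by (simp add: dist_norm algebra_simps)
    moreover have "z - z' \<in> Z" using z subspace_diff[OF assms] by blast
    ultimately show "d \<in> norm ` (+) (x - y) ` Z" by blast
  next
    fix d assume "d \<in> norm ` (+) (x - y) ` Z"
    then obtain z where z: "z \<in> Z" "d = norm (x - y + z)" by auto
    then have "d = dist (x + z) (y + 0)" by (simp add: dist_norm algebra_simps)
    then show "d \<in> {dist u v |u v. u \<in> (+) x ` Z \<and> v \<in> (+) y ` Z}"
      using z(1) subspace_0[OF assms] by blast
  qed
  moreover have "Z \<noteq> {}" using subspace_0[OF assms] by blast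
  ultimately show ?thesis by (simp add: setdist_def)
qed

lemma Metric_space_cosets:
  fixes Z :: "'a::real_normed_vector set"
  assumes "subspace Z" "closed Z"
  shows "Metric_space (cosets Z) setdist"
proof
  show "0 \<le> setdist C D" for C D :: "'a set" by (rule setdist_pos_le)
  show "setdist C D = setdist D C" for C D :: "'a set" by (rule setdist_sym)
  have tr: "(+) x ` Z = (+) y ` Z \<longleftrightarrow> x - y \<in> Z" for x y
  proof
    assume eq: "(+) x ` Z = (+) y ` Z"
    have "x \<in> (+) x ` Z" using subspace_0[OF assms(1)] by force
    with eq show "x - y \<in> Z" by auto
  next
    assume d: "x - y \<in> Z"
    show "(+) x ` Z = (+) y ` Z"
    proof (intro equalityI subsetI)
      fix w assume "w \<in> (+) x ` Z"
      then obtain z where z: "z \<in> Z" "w = x + z" by auto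
      then have "w = y + ((x - y) + z)" by simp
      then show "w \<in> (+) y ` Z" using subspace_add[OF assms(1) d z(1)] by blast
    next
      fix w assume "w \<in> (+) y ` Z"
      then obtain z where z: "z \<in> Z" "w = y + z" by auto
      then have "w = x + (z - (x - y))" by simp
      then show "w \<in> (+) x ` Z" using subspace_diff[OF assms(1) z(1) d] by blast
    qed
  qed
  have near: "\<exists>z\<in>Z. norm (x - y + z) < e" if "setdist ((+) x ` Z) ((+) y ` Z) < e" for x y e
  proof -
    have "Z \<noteq> {}" using subspace_0[OF assms(1)] by blast
    then show ?thesis using that unfolding setdist_cosets[OF assms(1)]
      by (subst (asm) cINF_less_iff) (auto intro: bdd_belowI[of _ 0])
  qed
  have le: "setdist ((+) x ` Z) ((+) y ` Z) \<le> norm (x - y + z)" if "z \<in> Z" for x y z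
    unfolding setdist_cosets[OF assms(1)]
    by (rule cINF_lower) (use that in \<open>auto intro: bdd_belowI[of _ 0]\<close>)
  show "setdist C D = 0 \<longleftrightarrow> C = D" if "C \<in> cosets Z" "D \<in> cosets Z" for C D
  proof -
    obtain x y where C: "C = (+) x ` Z" and D: "D = (+) y ` Z" using \<open>C \<in> cosets Z\<close> \<open>D \<in> cosets Z\<close> by (auto simp: cosets_def)
    show ?thesis
    proof
      assume "C = D" then show "setdist C D = 0" by (simp add: setdist_refl)
    next
      assume 0: "setdist C D = 0"
      have "y - x \<in> closure Z" unfolding closure_approachable
      proof (intro allI impI)
        fix e :: real assume "e > 0"
        then obtain z where "z \<in> Z" "norm (x - y + z) < e" using near[of x y e] 0 by (auto simp: C D)
        then show "\<exists>z\<in>Z. dist z (y - x) < e" by (auto simp: dist_norm algebra_simps)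
      qed
      then have "y - x \<in> Z" using assms(2) by simp
      then have "- (y - x) \<in> Z" by (rule subspace_neg[OF assms(1)])
      then show "C = D" by (simp add: C D tr)
    qed
  qed
  show "setdist C E \<le> setdist C D + setdist D E"
    if CDE: "C \<in> cosets Z" "D \<in> cosets Z" "E \<in> cosets Z" for C D E
  proof (rule field_le_epsilon)
    fix e :: real assume e: "e > 0"
    obtain x y w where C: "C = (+) x ` Z" and D: "D = (+) y ` Z" and E: "E = (+) w ` Z"
      using CDE unfolding cosets_def by blast
    obtain z1 where z1: "z1 \<in> Z" "norm (x - y + z1) < setdist C D + e/2"
      using near[of x y "setdist C D + e/2"] e by (auto simp: C D)
    obtain z2 where z2: "z2 \<in> Z" "norm (y - w + z2) < setdist D E + e/2"
      using near[of y w "setdist D E + e/2"] e by (auto simp: D E)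
    have "setdist C E \<le> norm (x - w + (z1 + z2))"
      unfolding C E by (rule le) (rule subspace_add[OF assms(1) z1(1) z2(1)])
    also have "x - w + (z1 + z2) = (x - y + z1) + (y - w + z2)" by simp
    also have "norm \<dots> \<le> norm (x - y + z1) + norm (y - w + z2)" by (rule norm_triangle_ineq)
    finally show "setdist C E \<le> setdist C D + setdist D E + e" using z1 z2 by simp
  qed
qed


section \<open>Extensible and automorphic spaces\<close>

definition extensible :: "'y::banach itself \<Rightarrow> 'x::banach itself \<Rightarrow> bool"
  where "extensible Y X \<longleftrightarrow>
    (\<forall>(Z :: 'x set) (T :: 'x \<Rightarrow> 'x).
      subspace Z \<and> closed Z \<and> isomorphic_to Z Y \<and> operator_on Z T \<longrightarrow>
      (\<exists>T'. bounded_linear T' \<and> (\<forall>z\<in>Z. T' z = T z)))"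

definition automorphic :: "'y::banach itself \<Rightarrow> 'x::banach itself \<Rightarrow> bool"
  where "automorphic Y X \<longleftrightarrow>
    (\<forall>(Z :: 'x set) (Z' :: 'x set) (T :: 'x \<Rightarrow> 'x).
      subspace Z \<and> closed Z \<and> isomorphic_to Z Y \<and>
      subspace Z' \<and> closed Z' \<and> isomorphic_to Z' Y \<and>
      dens (quotient_top Z) =o dens (quotient_top Z') \<and> isomorphism_on Z Z' T \<longrightarrow>
      (\<exists>T'. isomorphism_on UNIV UNIV T' \<and> (\<forall>z\<in>Z. T' z = T z)))"


section \<open>Martin's axiom for \<open>\<sigma>\<close>-linked partial orders\<close>

text \<open>A partial order is given by its carrier \<open>P\<close> and its relation \<open>r\<close>, with \<open>(p, q) \<in> r\<close> meaning
  \<open>p \<le> q\<close>.\<close>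

definition compatible_in :: "'p set \<Rightarrow> 'p rel \<Rightarrow> 'p \<Rightarrow> 'p \<Rightarrow> bool"
  where "compatible_in P r p q \<longleftrightarrow> (\<exists>s\<in>P. (s, p) \<in> r \<and> (s, q) \<in> r)"

definition sigma_linked :: "'p set \<Rightarrow> 'p rel \<Rightarrow> bool"
  where "sigma_linked P r \<longleftrightarrow>
    (\<exists>L :: nat \<Rightarrow> 'p set. P = (\<Union>n. L n) \<and> (\<forall>n. \<forall>p\<in>L n. \<forall>q\<in>L n. compatible_in P r p q))"

definition order_dense :: "'p set \<Rightarrow> 'p rel \<Rightarrow> 'p set \<Rightarrow> bool"
  where "order_dense P r D \<longleftrightarrow> D \<subseteq> P \<and> (\<forall>p\<in>P. \<exists>d\<in>D. (d, p) \<in> r)"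

definition order_filter :: "'p set \<Rightarrow> 'p rel \<Rightarrow> 'p set \<Rightarrow> bool"
  where "order_filter P r G \<longleftrightarrow> G \<subseteq> P \<and> G \<noteq> {} \<and>
    (\<forall>p\<in>G. \<forall>q\<in>P. (p, q) \<in> r \<longrightarrow> q \<in> G) \<and>
    (\<forall>p\<in>G. \<forall>q\<in>G. \<exists>s\<in>G. (s, p) \<in> r \<and> (s, q) \<in> r)"

definition MA_sigma_linked_on :: "'p itself \<Rightarrow> 'k rel \<Rightarrow> bool"
  where "MA_sigma_linked_on (_ :: 'p itself) \<kappa> \<longleftrightarrow>
    (\<forall>(P :: 'p set) r \<D>. P \<noteq> {} \<and> partial_order_on P r \<and> sigma_linked P r \<and>
      (\<forall>D\<in>\<D>. order_dense P r D) \<and> |\<D>| =o \<kappa> \<longrightarrow>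
      (\<exists>G. order_filter P r G \<and> (\<forall>D\<in>\<D>. G \<inter> D \<noteq> {})))"

text \<open>HOL cannot quantify over all types inside a proposition. Orders carried by subsets of a type of
  cardinality \<open>\<kappa>\<close> suffice: by \<open>MA_sigma_linked_any_type\<close> below, the
  statement for these implies the statement for orders carried by subsets of an arbitrary type.\<close>

abbreviation MA_sigma_linked :: "'k itself \<Rightarrow> bool"
  where "MA_sigma_linked k \<equiv> MA_sigma_linked_on k |UNIV :: 'k set|"

lemma MA_sigma_linked_embed:
  fixes h :: "'p \<Rightarrow> 'k"
  assumes MA: "MA_sigma_linked_on TYPE('k) \<kappa>" and inj: "inj_on h P"
    and P: "P \<noteq> {}" "partial_order_on P r" "sigma_linked P r"
    and D: "\<forall>D\<in>\<D>. order_dense P r D" "|\<D>| =o \<kappa>"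
  shows "\<exists>G. order_filter P r G \<and> (\<forall>D\<in>\<D>. G \<inter> D \<noteq> {})"
proof -
  note po = partial_order_onD[OF P(2)]
  define R where "R = map_prod h h ` r"
  have R: "(h p, h q) \<in> R \<longleftrightarrow> (p, q) \<in> r" if pq: "p \<in> P" "q \<in> P" for p q
  proof
    assume "(h p, h q) \<in> R"
    then obtain p' q' where r: "(p', q') \<in> r" and e: "h p = h p'" "h q = h q'" by (auto simp: R_def)
    then have "p' \<in> P" "q' \<in> P" using po(4) by auto
    then have "p' = p" "q' = q" using e pq inj_onD[OF inj] by metis+
    then show "(p, q) \<in> r" using r by simp
  next
    assume "(p, q) \<in> r" then show "(h p, h q) \<in> R" by (auto simp: R_def)
  qed
  have RP: "R \<subseteq> h ` P \<times> h ` P" using po(4) unfolding R_def by auto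
  have "refl_on (h ` P) R" using po(1) R by (auto simp: refl_on_def)
  moreover have "trans R"
  proof (rule transI)
    fix a b c assume ab: "(a, b) \<in> R" and bc: "(b, c) \<in> R"
    then obtain p q s where "p \<in> P" "q \<in> P" "s \<in> P" "a = h p" "b = h q" "c = h s" using RP by blast
    with ab bc show "(a, c) \<in> R" using R transD[OF po(2)] by metis
  qed
  moreover have "antisym R"
  proof (rule antisymI)
    fix a b assume ab: "(a, b) \<in> R" "(b, a) \<in> R"
    then obtain p q where "p \<in> P" "q \<in> P" "a = h p" "b = h q" using RP by blast
    with ab show "a = b" using R antisymD[OF po(3)] by metis
  qed
  ultimately have poR: "partial_order_on (h ` P) R"
    using RP by (simp add: partial_order_on_def preorder_on_def)
  obtain L :: "nat \<Rightarrow> 'p set" where L: "P = (\<Union>n. L n)" "\<And>n p q. p \<in> L n \<Longrightarrow> q \<in> L n \<Longrightarrow> compatible_in P r p q"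
    using P(3) unfolding sigma_linked_def by auto
  have "sigma_linked (h ` P) R" unfolding sigma_linked_def
  proof (intro exI[of _ "\<lambda>n. h ` L n"] conjI allI ballI)
    show "h ` P = (\<Union>n. h ` L n)" using L(1) by auto
    fix n a b assume "a \<in> h ` L n" "b \<in> h ` L n"
    then obtain p q where pq: "p \<in> L n" "q \<in> L n" "a = h p" "b = h q" by auto
    then have "p \<in> P" "q \<in> P" using L(1) by auto
    then show "compatible_in (h ` P) R a b"
      using L(2)[OF pq(1,2)] R pq unfolding compatible_in_def by auto
  qed
  moreover have "\<forall>D\<in>(`) h ` \<D>. order_dense (h ` P) R D"
  proof
    fix E assume "E \<in> (`) h ` \<D>"
    then obtain D0 where D0: "D0 \<in> \<D>" "E = h ` D0" by auto
    then have "order_dense P r D0" using D(1) by blast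
    then show "order_dense (h ` P) R E" using R D0(2) unfolding order_dense_def by (auto simp: subset_iff)
  qed
  moreover have "|(`) h ` \<D>| =o \<kappa>"
  proof -
    have "\<D> \<subseteq> Pow P" using D(1) by (auto simp: order_dense_def)
    then have "inj_on ((`) h) \<D>" using inj_on_image_Pow[OF inj] inj_on_subset by blast
    then have "bij_betw ((`) h) \<D> ((`) h ` \<D>)" by (simp add: bij_betw_def)
    then have "|\<D>| =o |(`) h ` \<D>|" using card_of_ordIso by blast
    then show ?thesis using D(2) ordIso_symmetric ordIso_transitive by blast
  qed
  ultimately obtain G where G: "order_filter (h ` P) R G" "\<forall>D\<in>(`) h ` \<D>. G \<inter> D \<noteq> {}"
    using MA P(1) poR unfolding MA_sigma_linked_on_def by (metis image_is_empty)
  define H where "H = {p\<in>P. h p \<in> G}"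
  have GH: "G = h ` H" using G(1) unfolding order_filter_def H_def by auto
  have HP: "H \<subseteq> P" by (auto simp: H_def)
  have "order_filter P r H" unfolding order_filter_def
  proof (intro conjI ballI impI)
    show "H \<subseteq> P" by (rule HP)
    show "H \<noteq> {}" using G(1) GH by (auto simp: order_filter_def)
    show "q \<in> H" if "p \<in> H" "q \<in> P" "(p, q) \<in> r" for p q
      using that G(1) R[of p q] unfolding order_filter_def H_def by blast
    show "\<exists>s\<in>H. (s, p) \<in> r \<and> (s, q) \<in> r" if "p \<in> H" "q \<in> H" for p q
    proof -
      have "\<exists>s\<in>G. (s, h p) \<in> R \<and> (s, h q) \<in> R" using that G(1) GH unfolding order_filter_def by blast
      then obtain s where "s \<in> H" "(h s, h p) \<in> R" "(h s, h q) \<in> R" using GH by blast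
      then show ?thesis using R that HP by blast
    qed
  qed
  moreover have "H \<inter> D \<noteq> {}" if "D \<in> \<D>" for D
  proof -
    have "G \<inter> h ` D \<noteq> {}" using G(2) that by blast
    moreover have "D \<subseteq> P" using D(1) that by (auto simp: order_dense_def)
    ultimately show ?thesis unfolding H_def by blast
  qed
  ultimately show ?thesis by blast
qed

theorem MA_sigma_linked_any_type:
  assumes inf: "infinite (UNIV :: 'k set)" and MA: "MA_sigma_linked TYPE('k)"
  shows "MA_sigma_linked_on TYPE('p) |UNIV :: 'k set|"
  unfolding MA_sigma_linked_on_def
proof (intro allI impI, elim conjE)
  fix P :: "'p set" and r \<D>
  assume P: "P \<noteq> {}" "partial_order_on P r" "sigma_linked P r"
    and D: "\<forall>D\<in>\<D>. order_dense P r D" and cD: "|\<D>| =o |UNIV :: 'k set|"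
  note po = partial_order_onD[OF P(2)]
  have rP: "(p, p) \<in> r" if "p \<in> P" for p using po(1) that by (auto simp: refl_on_def)
  obtain L :: "nat \<Rightarrow> 'p set" where L: "P = (\<Union>n. L n)" "\<And>n p q. p \<in> L n \<Longrightarrow> q \<in> L n \<Longrightarrow> compatible_in P r p q"
    using P(3) unfolding sigma_linked_def by auto
  obtain p0 where p0: "p0 \<in> P" using P(1) by blast
  have "\<forall>x. \<exists>d. fst x \<in> \<D> \<and> snd x \<in> P \<longrightarrow> d \<in> fst x \<and> (d, snd x) \<in> r"
    using D unfolding order_dense_def by blast
  then obtain f where f: "\<And>D p. D \<in> \<D> \<Longrightarrow> p \<in> P \<Longrightarrow> f (D, p) \<in> D \<and> (f (D, p), p) \<in> r"
    by (metis fst_conv snd_conv)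
  have "\<forall>x. \<exists>s. compatible_in P r (fst x) (snd x) \<longrightarrow> s \<in> P \<and> (s, fst x) \<in> r \<and> (s, snd x) \<in> r"
    by (auto simp: compatible_in_def)
  then obtain g where g: "\<And>p q. compatible_in P r p q \<Longrightarrow> g (p, q) \<in> P \<and> (g (p, q), p) \<in> r \<and> (g (p, q), q) \<in> r"
    by (metis fst_conv snd_conv)
  define S where "S = rec_nat {p0} (\<lambda>_ A. A \<union> f ` (\<D> \<times> A) \<union> g ` {x\<in>A \<times> A. compatible_in P r (fst x) (snd x)})"
  have S0: "S 0 = {p0}"
    and SS: "\<And>n. S (Suc n) = S n \<union> f ` (\<D> \<times> S n) \<union> g ` {x\<in>S n \<times> S n. compatible_in P r (fst x) (snd x)}"
    by (simp_all add: S_def)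
  have SP: "S n \<subseteq> P" for n
  proof (induction n)
    case 0 then show ?case using p0 by (simp add: S0)
  next
    case (Suc n)
    have "f ` (\<D> \<times> S n) \<subseteq> P" using f D Suc by (fastforce simp: order_dense_def)
    moreover have "g ` {x\<in>S n \<times> S n. compatible_in P r (fst x) (snd x)} \<subseteq> P" using g by auto
    ultimately show ?case using Suc by (simp add: SS)
  qed
  let ?k = "|UNIV :: 'k set|"
  have infk: "\<not> finite (Field ?k)" using inf by (simp add: card_of_Field_ordIso Field_card_of)
  have co: "Card_order ?k" by (rule card_of_Card_order)
  have cS: "|S n| \<le>o ?k" for n
  proof (induction n)
    case 0
    have "|{p0}| \<le>o ?k"
      using card_of_singl_ordLeq[of "UNIV :: 'k set" p0] by simp
    then show ?case by (simp add: S0)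
  next
    case (Suc n)
    have "|f ` (\<D> \<times> S n)| \<le>o ?k"
      by (rule ordLeq_transitive[OF card_of_image
          card_of_Times_ordLeq_infinite_Field[OF infk ordIso_imp_ordLeq[OF cD] Suc co]])
    moreover have "|g ` {x\<in>S n \<times> S n. compatible_in P r (fst x) (snd x)}| \<le>o ?k"
    proof -
      have "|{x\<in>S n \<times> S n. compatible_in P r (fst x) (snd x)}| \<le>o |S n \<times> S n|"
        by (rule card_of_mono1) auto
      from ordLeq_transitive[OF this card_of_Times_ordLeq_infinite_Field[OF infk Suc Suc co]]
      show ?thesis by (rule ordLeq_transitive[OF card_of_image])
    qed
    ultimately show ?case unfolding SS using Suc infk co by (intro card_of_Un_ordLeq_infinite_Field)
  qed
  define Q where "Q = (\<Union>n. S n)"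
  have QP: "Q \<subseteq> P" using SP by (auto simp: Q_def)
  have p0Q: "p0 \<in> Q" unfolding Q_def using S0 by blast
  have fQ: "f (D, p) \<in> Q" if Dp: "D \<in> \<D>" "p \<in> Q" for D p
  proof -
    obtain n where "p \<in> S n" using Dp(2) by (auto simp: Q_def)
    then have "f (D, p) \<in> S (Suc n)" using Dp(1) by (auto simp: SS)
    then show ?thesis unfolding Q_def by blast
  qed
  have mono: "S m \<subseteq> S n" if "m \<le> n" for m n
    by (rule lift_Suc_mono_le[of S, OF _ that]) (auto simp: SS)
  have gQ: "g (p, q) \<in> Q" if pq: "p \<in> Q" "q \<in> Q" "compatible_in P r p q" for p q
  proof -
    obtain m n where "p \<in> S m" "q \<in> S n" using pq(1,2) by (auto simp: Q_def)
    then have "p \<in> S (max m n)" "q \<in> S (max m n)"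
      using mono[of m "max m n"] mono[of n "max m n"] by auto
    then have "g (p, q) \<in> S (Suc (max m n))" using pq(3) by (auto simp: SS)
    then show ?thesis unfolding Q_def by blast
  qed
  have cQ: "|Q| \<le>o ?k" unfolding Q_def
    by (rule card_of_UNION_ordLeq_infinite[OF inf]) (use cS inf infinite_iff_card_of_nat in auto)
  define M :: "('p + 'k) set" where "M = Q <+> UNIV"
  have "|M| \<le>o ?k" unfolding M_def
    by (rule card_of_Plus_ordLeq_infinite_Field[OF infk cQ _ co]) (rule card_of_mono1, simp)
  then obtain h :: "'p + 'k \<Rightarrow> 'k" where h: "inj_on h M" using card_of_ordLeq[of M "UNIV :: 'k set"] by blast
  define R :: "('p + 'k) rel" where "R = {(Inl p, Inl q) |p q. p \<in> Q \<and> q \<in> Q \<and> (p, q) \<in> r}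
    \<union> {(Inl p, Inr i) |p i. p \<in> Q} \<union> {(Inr i, Inr i) |i. True}"
  have "partial_order_on M R"
    unfolding partial_order_on_def preorder_on_def
  proof (intro conjI)
    show "R \<subseteq> M \<times> M" by (auto simp: R_def M_def)
    show "refl_on M R" using rP QP by (auto simp: refl_on_def R_def M_def)
    show "trans R"
    proof (rule transI)
      fix a b c assume "(a, b) \<in> R" "(b, c) \<in> R"
      then show "(a, c) \<in> R" unfolding R_def by (auto intro: transD[OF po(2)])
    qed
    show "antisym R"
    proof (rule antisymI)
      fix a b assume "(a, b) \<in> R" "(b, a) \<in> R"
      then show "a = b" unfolding R_def by (auto intro: antisymD[OF po(3)])
    qed
  qed
  moreover have "sigma_linked M R" unfolding sigma_linked_def
  proof (intro exI[of _ "\<lambda>n. case n of 0 \<Rightarrow> range Inr | Suc n \<Rightarrow> Inl ` (L n \<inter> Q)"] conjI allI ballI)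
    show "M = (\<Union>n. case n of 0 \<Rightarrow> range Inr | Suc n \<Rightarrow> Inl ` (L n \<inter> Q))" (is "_ = (\<Union>n. ?L n)")
    proof
      have "Inl p \<in> (\<Union>n. ?L n)" if pQ: "p \<in> Q" for p
      proof -
        obtain n where "p \<in> L n" using pQ QP L(1) by blast
        then have "Inl p \<in> ?L (Suc n)" using pQ by simp
        then show ?thesis by blast
      qed
      moreover have "Inr i \<in> (\<Union>n. ?L n)" for i by (rule UN_I[of "0::nat"]) auto
      ultimately show "M \<subseteq> (\<Union>n. ?L n)" by (auto simp: M_def)
      show "(\<Union>n. ?L n) \<subseteq> M" by (auto simp: M_def split: nat.splits)
    qed
    fix n and a b :: "'p + 'k"
    assume a: "a \<in> (case n of 0 \<Rightarrow> range Inr | Suc n \<Rightarrow> Inl ` (L n \<inter> Q))"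
      and b: "b \<in> (case n of 0 \<Rightarrow> range Inr | Suc n \<Rightarrow> Inl ` (L n \<inter> Q))"
    show "compatible_in M R a b"
    proof (cases n)
      case 0
      then show ?thesis using a b p0Q unfolding compatible_in_def
        by (intro bexI[of _ "Inl p0"]) (auto simp: R_def M_def)
    next
      case (Suc m)
      then obtain p q where pq: "a = Inl p" "b = Inl q" "p \<in> L m" "q \<in> L m" "p \<in> Q" "q \<in> Q"
        using a b by auto
      have c: "compatible_in P r p q" by (rule L(2)[OF pq(3,4)])
      show ?thesis using g[OF c] gQ[OF pq(5,6) c] pq unfolding compatible_in_def
        by (intro bexI[of _ "Inl (g (p, q))"]) (auto simp: R_def M_def)
    qed
  qed
  moreover
  define \<E> :: "('p + 'k) set set" where "\<E> = (\<lambda>D. Inl ` (D \<inter> Q)) ` \<D> \<union> range (\<lambda>i. insert (Inr i) (Inl ` Q))"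
  have DE: "order_dense M R (Inl ` (D \<inter> Q))" if "D \<in> \<D>" for D
    unfolding order_dense_def
  proof (intro conjI ballI)
    show "Inl ` (D \<inter> Q) \<subseteq> M" by (auto simp: M_def)
    fix x assume "x \<in> M"
    then consider p where "x = Inl p" "p \<in> Q" | i where "x = Inr i" by (auto simp: M_def)
    then show "\<exists>d\<in>Inl ` (D \<inter> Q). (d, x) \<in> R"
    proof cases
      case (1 p)
      then show ?thesis using f[OF that, of p] fQ[OF that, of p] QP
        by (intro bexI[of _ "Inl (f (D, p))"]) (auto simp: R_def)
    next
      case (2 i)
      then show ?thesis using f[OF that, of p0] fQ[OF that, of p0] p0 p0Q
        by (intro bexI[of _ "Inl (f (D, p0))"]) (auto simp: R_def)
    qed
  qed
  have "order_dense M R (insert (Inr i) (Inl ` Q))" for i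
    unfolding order_dense_def
  proof (intro conjI ballI)
    show "insert (Inr i) (Inl ` Q) \<subseteq> M" by (auto simp: M_def)
    fix x assume "x \<in> M"
    then consider p where "x = Inl p" "p \<in> Q" | j where "x = Inr j" by (auto simp: M_def)
    then show "\<exists>d\<in>insert (Inr i) (Inl ` Q). (d, x) \<in> R"
      by cases (use p0Q rP QP in \<open>auto simp: R_def\<close>)
  qed
  with DE have "\<forall>D\<in>\<E>. order_dense M R D" by (auto simp: \<E>_def)
  moreover have "|\<E>| =o ?k"
  proof -
    have "|(\<lambda>D. Inl ` (D \<inter> Q) :: ('p + 'k) set) ` \<D>| \<le>o ?k"
      by (rule ordLeq_transitive[OF card_of_image ordIso_imp_ordLeq[OF cD]])
    moreover have "|range (\<lambda>i. insert (Inr i) (Inl ` Q) :: ('p + 'k) set)| \<le>o ?k" by (rule card_of_image)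
    ultimately have "|\<E>| \<le>o ?k" unfolding \<E>_def using infk co by (intro card_of_Un_ordLeq_infinite_Field)
    moreover have "?k \<le>o |\<E>|"
    proof -
      have "inj (\<lambda>i. insert (Inr i) (Inl ` Q) :: ('p + 'k) set)" by (rule injI) auto
      moreover have "range (\<lambda>i. insert (Inr i) (Inl ` Q)) \<subseteq> \<E>" by (auto simp: \<E>_def)
      ultimately show ?thesis using card_of_ordLeq[of "UNIV :: 'k set" \<E>] by blast
    qed
    ultimately show ?thesis by (simp add: ordIso_iff_ordLeq)
  qed
  moreover have "M \<noteq> {}" using p0Q by (auto simp: M_def)
  ultimately obtain G where G: "order_filter M R G" and GE: "\<forall>D\<in>\<E>. G \<inter> D \<noteq> {}"
    using MA_sigma_linked_embed[OF MA h, of R \<E>] by blast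
  define H where "H = {p\<in>P. \<exists>q\<in>Q. Inl q \<in> G \<and> (q, p) \<in> r}"
  have HD: "H \<inter> D \<noteq> {}" if "D \<in> \<D>" for D
  proof -
    have "G \<inter> Inl ` (D \<inter> Q) \<noteq> {}" using GE that by (auto simp: \<E>_def)
    then obtain d where "Inl d \<in> G" "d \<in> D" "d \<in> Q" by blast
    then have "d \<in> H" using QP rP by (auto simp: H_def)
    then show ?thesis using \<open>d \<in> D\<close> by blast
  qed
  have "\<D> \<noteq> {}"
  proof
    assume "\<D> = {}"
    then have "finite (UNIV :: 'k set)" using card_of_ordIso_finite[OF cD] by simp
    then show False using inf by simp
  qed
  then have "H \<noteq> {}" using HD by blast
  have "order_filter P r H" unfolding order_filter_def
  proof (intro conjI ballI impI)
    show "H \<subseteq> P" by (auto simp: H_def)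
    show "H \<noteq> {}" by fact
    show "q \<in> H" if "p \<in> H" "q \<in> P" "(p, q) \<in> r" for p q
      using that transD[OF po(2)] unfolding H_def by blast
    show "\<exists>s\<in>H. (s, p) \<in> r \<and> (s, q) \<in> r" if pq: "p \<in> H" "q \<in> H" for p q
    proof -
      obtain p' q' where p': "Inl p' \<in> G" "(p', p) \<in> r" and q': "Inl q' \<in> G" "(q', q) \<in> r"
        using pq by (auto simp: H_def)
      then obtain x where x: "x \<in> G" "(x, Inl p') \<in> R" "(x, Inl q') \<in> R"
        using G unfolding order_filter_def by blast
      then obtain s where s: "x = Inl s" "s \<in> Q" "(s, p') \<in> r" "(s, q') \<in> r" by (auto simp: R_def)
      then have "s \<in> H" using x(1) QP rP by (auto simp: H_def)
      moreover have "(s, p) \<in> r" "(s, q) \<in> r" using s p' q' transD[OF po(2)] by blast+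
      ultimately show ?thesis by blast
    qed
  qed
  then show "\<exists>G. order_filter P r G \<and> (\<forall>D\<in>\<D>. G \<inter> D \<noteq> {})" using HD by blast
qed

end

theory Submission
  imports Defs
begin

text \<open>Let \<open>J, K\<close> be operators from \<open>c\<^sub>0(\<kappa>)\<close> to \<open>\<ell>\<^sub>\<infinity>/c\<^sub>0\<close> with \<open>J\<close> bounded below. A filter for a \<open>\<sigma>\<close>-linked order of
  finite approximations yields an infinite matrix with finitely supported rational rows that induces an operator \<open>U\<close>
  on \<open>\<ell>\<^sub>\<infinity>/c\<^sub>0\<close> with \<open>U J = K\<close>. This is extensibility.

  For automorphisms, a Cohen generic set \<open>A \<subseteq> \<nat>\<close> splits \<open>J\<close>: already its restriction \<open>P\<^sub>A J\<close> to \<open>A\<close> is bounded below.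
  Hence \<open>P\<^sub>-\<^sub>A J\<close> factors through \<open>P\<^sub>A J\<close>, and an automorphism of the form \<open>1 + N\<close> with \<open>N\<^sup>2 = 0\<close> moves the range of
  \<open>J\<close> into \<open>\<ell>\<^sub>\<infinity>(A)/c\<^sub>0(A)\<close>. After a permutation of \<open>\<nat>\<close>, two embeddings thus live on complementary sets, where
  extensions \<open>U, W\<close> of the isomorphism between their ranges and of its inverse give the automorphism
  \<open>(1 - W)(1 + U)\<close>, which maps one embedding to the other.\<close>

section \<open>Filters for indexed families of dense sets\<close>

text \<open>Induction on the length bounds the lists of each fixed length, and a countable union
  does not exceed an infinite cardinal. The lemma serves to count requirements that are indexed by
  lists.\<close>

lemma card_of_lists_ordLeq:
  assumes "infinite (UNIV :: 'k set)" and "|UNIV :: 'a set| \<le>o |UNIV :: 'k set|"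
  shows "|UNIV :: 'a list set| \<le>o |UNIV :: 'k set|"
proof -
  have inf: "infinite (Field |UNIV :: 'k set| )" using assms(1) by (simp add: Field_card_of)
  have "|{xs :: 'a list. length xs = n}| \<le>o |UNIV :: 'k set|" for n
  proof (induction n)
    case 0
    then show ?case using card_of_singl_ordLeq[of "UNIV :: 'k set" "[] :: 'a list"] by simp
  next
    case (Suc n)
    have "{xs :: 'a list. length xs = Suc n} = (\<lambda>(x, xs). x # xs) ` (UNIV \<times> {xs. length xs = n})"
      by (auto simp: length_Suc_conv image_iff)
    moreover have "|(UNIV :: 'a set) \<times> {xs :: 'a list. length xs = n}| \<le>o |UNIV :: 'k set|"
      by (rule card_of_Times_ordLeq_infinite_Field[OF inf assms(2) Suc card_of_Card_order])
    ultimately show ?case using card_of_image ordLeq_transitive by metis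
  qed
  then have "|\<Union>n. {xs :: 'a list. length xs = n}| \<le>o |UNIV :: 'k set|"
    using assms(1) infinite_iff_card_of_nat by (intro card_of_UNION_ordLeq_infinite) auto
  moreover have "(\<Union>n. {xs :: 'a list. length xs = n}) = UNIV" by auto
  ultimately show ?thesis by metis
qed

lemma card_of_prod_ordLeq:
  assumes "infinite (UNIV :: 'k set)" "|UNIV :: 'a set| \<le>o |UNIV :: 'k set|" "|UNIV :: 'b set| \<le>o |UNIV :: 'k set|"
  shows "|UNIV :: ('a \<times> 'b) set| \<le>o |UNIV :: 'k set|"
  using card_of_Times_ordLeq_infinite_Field[OF _ assms(2,3) card_of_Card_order] assms(1)
  by (simp add: Field_card_of)

lemma card_of_countable_ordLeq:
  assumes "infinite (UNIV :: 'k set)"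
  shows "|UNIV :: 'a::countable set| \<le>o |UNIV :: 'k set|"
proof -
  have "|UNIV :: 'a set| \<le>o |UNIV :: nat set|"
    using card_of_ordLeq[of "UNIV :: 'a set" "UNIV :: nat set"] by auto
  then show ?thesis using assms infinite_iff_card_of_nat ordLeq_transitive by blast
qed

text \<open>The order is multiplied by the finite subsets of \<^typ>\<open>'k\<close>, ordered by reverse inclusion, which
  supplies exactly \<open>\<kappa>\<close> distinct dense sets even if the given family is smaller.\<close>

lemma MA_sigma_linked_filter:
  fixes D :: "'i \<Rightarrow> 'p set"
  assumes inf: "infinite (UNIV :: 'k set)" and MA: "MA_sigma_linked TYPE('k)"
    and P: "P \<noteq> {}" "partial_order_on P r" "sigma_linked P r"
    and D: "\<And>i. order_dense P r (D i)" and card: "|UNIV :: 'i set| \<le>o |UNIV :: 'k set|"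
  obtains G where "order_filter P r G" "\<And>i. G \<inter> D i \<noteq> {}"
proof -
  note po = partial_order_onD[OF P(2)]
  have rP: "(p, p) \<in> r" if "p \<in> P" for p using po(1) that by (auto simp: refl_on_def)
  define Q where "Q = P \<times> {A :: 'k set. finite A}"
  define R where "R = {((p, A), (q, B)) |p q A B :: 'k set. (p, q) \<in> r \<and> finite A \<and> finite B \<and> B \<subseteq> A}"
  have R_iff: "((p, A), (q, B)) \<in> R \<longleftrightarrow> (p, q) \<in> r \<and> finite A \<and> finite B \<and> B \<subseteq> A" for p q A B
    by (auto simp: R_def)
  have "partial_order_on Q R"
    unfolding partial_order_on_def preorder_on_def
  proof (intro conjI)
    show "R \<subseteq> Q \<times> Q" using po(4) by (auto simp: R_def Q_def)
    show "refl_on Q R" using rP by (auto simp: refl_on_def R_iff Q_def)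
    show "trans R" unfolding trans_def R_def by (auto intro: transD[OF po(2)])
    show "antisym R" by (rule antisymI) (auto simp: R_def intro: antisymD[OF po(3)])
  qed
  moreover have "sigma_linked Q R"
  proof -
    obtain L :: "nat \<Rightarrow> 'p set" where L: "P = (\<Union>n. L n)" "\<And>n p q. p \<in> L n \<Longrightarrow> q \<in> L n \<Longrightarrow> compatible_in P r p q"
      using P(3) unfolding sigma_linked_def by auto
    \<comment> \<open>The finite sets never obstruct compatibility, as their union is a common
      strengthening. So each linked piece of \<open>P\<close> may be combined with all finite sets
      at once.\<close>
    have "compatible_in Q R (p, A) (q, B)" if pq: "p \<in> L n" "q \<in> L n" and AB: "finite A" "finite B" for n p q A B
    proof -
      obtain s where "s \<in> P" "(s, p) \<in> r" "(s, q) \<in> r"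
        using L(2)[OF pq] unfolding compatible_in_def by blast
      then show ?thesis using AB unfolding compatible_in_def
        by (intro bexI[of _ "(s, A \<union> B)"]) (auto simp: R_iff Q_def)
    qed
    then show ?thesis unfolding sigma_linked_def
      by (intro exI[of _ "\<lambda>n. L n \<times> {A. finite A}"]) (auto simp: Q_def L(1))
  qed
  moreover
  define \<E> where "\<E> = range (\<lambda>i. D i \<times> {A :: 'k set. finite A}) \<union> range (\<lambda>k. P \<times> {A :: 'k set. finite A \<and> k \<in> A})"
  have "order_dense Q R (D i \<times> {A. finite A})" for i
    unfolding order_dense_def
  proof (intro conjI ballI)
    show "D i \<times> {A. finite A} \<subseteq> Q" using D[of i] by (auto simp: Q_def order_dense_def)
    fix x assume "x \<in> Q"
    then obtain p A where "x = (p, A)" "p \<in> P" "finite A" by (auto simp: Q_def)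
    then show "\<exists>d\<in>D i \<times> {A. finite A}. (d, x) \<in> R"
      using D[of i] unfolding order_dense_def by (auto simp: R_iff)
  qed
  moreover have "order_dense Q R (P \<times> {A. finite A \<and> k \<in> A})" for k
    unfolding order_dense_def
  proof (intro conjI ballI)
    show "P \<times> {A. finite A \<and> k \<in> A} \<subseteq> Q" by (auto simp: Q_def)
    fix x assume "x \<in> Q"
    then obtain p A where "x = (p, A)" "p \<in> P" "finite A" by (auto simp: Q_def)
    then show "\<exists>d\<in>P \<times> {A. finite A \<and> k \<in> A}. (d, x) \<in> R"
      using rP by (intro bexI[of _ "(p, insert k A)"]) (auto simp: R_iff)
  qed
  ultimately have "\<forall>E\<in>\<E>. order_dense Q R E" by (auto simp: \<E>_def)
  moreover have "|\<E>| =o |UNIV :: 'k set|"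
  proof -
    have "|range (\<lambda>i. D i \<times> {A :: 'k set. finite A})| \<le>o |UNIV :: 'k set|"
      by (rule ordLeq_transitive[OF card_of_image card])
    moreover have "|range (\<lambda>k. P \<times> {A :: 'k set. finite A \<and> k \<in> A})| \<le>o |UNIV :: 'k set|"
      by (rule card_of_image)
    ultimately have "|\<E>| \<le>o |UNIV :: 'k set|" unfolding \<E>_def
      using inf by (intro card_of_Un_ordLeq_infinite_Field card_of_Card_order) (simp_all add: Field_card_of)
    moreover have "|UNIV :: 'k set| \<le>o |\<E>|"
    proof -
      have "inj (\<lambda>k. P \<times> {A :: 'k set. finite A \<and> k \<in> A})"
      proof (rule injI)
        fix k l :: 'k assume eq: "P \<times> {A. finite A \<and> k \<in> A} = P \<times> {A. finite A \<and> l \<in> A}"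
        obtain p where "p \<in> P" using P(1) by blast
        then have "(p, {k}) \<in> P \<times> {A. finite A \<and> k \<in> A}" by simp
        then show "k = l" unfolding eq by simp
      qed
      moreover have "range (\<lambda>k. P \<times> {A :: 'k set. finite A \<and> k \<in> A}) \<subseteq> \<E>" by (auto simp: \<E>_def)
      ultimately show ?thesis using card_of_ordLeq[of "UNIV :: 'k set" \<E>] by blast
    qed
    ultimately show ?thesis by (simp add: ordIso_iff_ordLeq)
  qed
  moreover have "Q \<noteq> {}" using P(1) by (auto simp: Q_def)
  ultimately obtain H where H: "order_filter Q R H" "\<And>E. E \<in> \<E> \<Longrightarrow> H \<inter> E \<noteq> {}"
    using \<open>partial_order_on Q R\<close> \<open>sigma_linked Q R\<close> MA_sigma_linked_any_type[where 'p = "'p \<times> 'k set", OF inf MA]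
    unfolding MA_sigma_linked_on_def by metis
  note Hf = H(1)[unfolded order_filter_def]
  show thesis
  proof
    show "order_filter P r (fst ` H)"
      unfolding order_filter_def
    proof (intro conjI ballI impI)
      show "fst ` H \<subseteq> P" using Hf by (auto simp: Q_def)
      show "fst ` H \<noteq> {}" using Hf by auto
      fix p q assume p: "p \<in> fst ` H"
      then obtain A where A: "(p, A) \<in> H" by auto
      show "q \<in> fst ` H" if "q \<in> P" "(p, q) \<in> r"
      proof -
        have "finite A" using A Hf by (auto simp: Q_def)
        then have "(q, A) \<in> H" using A that Hf by (auto simp: Q_def R_iff)
        then show ?thesis by force
      qed
      show "\<exists>s\<in>fst ` H. (s, p) \<in> r \<and> (s, q) \<in> r" if "q \<in> fst ` H"
      proof -
        obtain B where "(q, B) \<in> H" using \<open>q \<in> fst ` H\<close> by auto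
        then obtain x where "x \<in> H" "(x, (p, A)) \<in> R" "(x, (q, B)) \<in> R" using A Hf by blast
        then show ?thesis by (intro bexI[of _ "fst x"]) (auto simp: R_def)
      qed
    qed
    show "fst ` H \<inter> D i \<noteq> {}" for i
    proof -
      have "H \<inter> D i \<times> {A. finite A} \<noteq> {}" by (rule H(2)) (simp add: \<E>_def)
      then show ?thesis by force
    qed
  qed
qed

section \<open>Rational combinations of unit vectors\<close>

lift_definition c0_unit :: "'k \<Rightarrow> 'k c0" is "\<lambda>k i. if i = k then 1 else 0"
proof -
  fix k :: 'k and e :: real assume "0 < e"
  then show "finite {i. e \<le> \<bar>if i = k then 1 else 0\<bar>}"
    by (auto intro!: rev_finite_subset[of "{k}"])
qed

lemma c0_apply_sum_units:
  assumes "finite F"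
  shows "c0_apply (\<Sum>k\<in>F. a k *\<^sub>R c0_unit k) i = (if i \<in> F then a i else 0)"
  using assms
  by (induction F rule: finite_induct) (auto simp: zero_c0.rep_eq plus_c0.rep_eq scaleR_c0.rep_eq c0_unit.rep_eq)

text \<open>Lists with rational coefficients serve as codes, at most \<open>\<kappa>\<close> many
  when \<open>\<kappa>\<close> is infinite; the coefficients of a repeated index add up.\<close>

definition rat_comb :: "('k \<times> rat) list \<Rightarrow> 'k c0"
  where "rat_comb xs = (\<Sum>(k, q)\<leftarrow>xs. of_rat q *\<^sub>R c0_unit k)"

text \<open>Only finitely many coordinates of \<open>v\<close> reach \<open>e/2\<close> in absolute
  value; these are replaced by nearby rationals and all others by 0.\<close>

lemma closure_rat_comb: "closure (range rat_comb) = (UNIV :: 'k c0 set)"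
proof -
  have "\<exists>xs. dist (rat_comb xs) v < e" if e: "0 < e" for v :: "'k c0" and e
  proof -
    define F where "F = {i. e/2 \<le> \<bar>c0_apply v i\<bar>}"
    have F: "finite F" unfolding F_def by (rule c0_apply[of v, unfolded mem_Collect_eq, rule_format, OF half_gt_zero[OF e]])
    obtain ks where ks: "set ks = F" "distinct ks" using finite_distinct_list[OF F] by blast
    have "\<exists>q. \<bar>c0_apply v i - of_rat q\<bar> < e/2" for i
    proof -
      obtain q where "c0_apply v i < of_rat q" "of_rat q < c0_apply v i + e/2"
        using of_rat_dense[of "c0_apply v i" "c0_apply v i + e/2"] e by auto
      then show ?thesis by (intro exI[of _ q]) auto
    qed
    then obtain q where q: "\<And>i. \<bar>c0_apply v i - of_rat (q i)\<bar> < e/2" by metis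
    define xs where "xs = map (\<lambda>k. (k, q k)) ks"
    have "rat_comb xs = (\<Sum>k\<in>F. of_rat (q k) *\<^sub>R c0_unit k)"
      using ks by (simp add: rat_comb_def xs_def comp_def sum_list_distinct_conv_sum_set)
    then have c: "c0_apply (rat_comb xs) i = (if i \<in> F then of_rat (q i) else 0)" for i
      by (simp add: c0_apply_sum_units[OF F])
    have "norm (rat_comb xs - v) \<le> e/2"
    proof (rule c0_norm_le)
      show "\<bar>c0_apply (rat_comb xs - v) i\<bar> \<le> e/2" for i
        using q[of i] by (auto simp: c0_apply_minus c F_def abs_minus_commute)
    qed
    then show ?thesis using e by (auto simp: dist_norm intro!: exI[of _ xs])
  qed
  then show ?thesis by (auto simp: closure_approachable)
qed

lemma bounded_linear_c0_eqI:
  fixes U V :: "'k c0 \<Rightarrow> 'b::real_normed_vector"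
  assumes "bounded_linear U" "bounded_linear V" "\<And>k. U (c0_unit k) = V (c0_unit k)"
  shows "U v = V v"
proof -
  interpret U: bounded_linear U by fact
  interpret V: bounded_linear V by fact
  have "U (rat_comb xs) = V (rat_comb xs)" for xs
    unfolding rat_comb_def
    by (induction xs) (auto simp: U.zero V.zero U.add V.add U.scaleR V.scaleR assms(3))
  then have "range rat_comb \<subseteq> {v. U v = V v}" by auto
  moreover have "closed {v. U v = V v}"
    by (intro closed_Collect_eq linear_continuous_on assms)
  ultimately have "closure (range rat_comb) \<subseteq> {v. U v = V v}" by (rule closure_minimal)
  then show ?thesis by (auto simp: closure_rat_comb)
qed

section \<open>Classes modulo null sequences and matrix operators\<close>

lemma linf_of_bounded:
  assumes "\<And>n. \<bar>u n\<bar> \<le> b"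
  shows "\<exists>g :: linf. apply_bcontfun g = u"
proof -
  have "u \<in> bcontfun" by (rule bcontfun_normI[of _ b]) (use assms in \<open>auto intro: continuous_on_discrete\<close>)
  then show ?thesis by (metis Bcontfun_inverse)
qed

section \<open>The quotient norm as a limit superior\<close>

lemma abs_linf_mod_c0_eq_iff:
  "abs_linf_mod_c0 f = abs_linf_mod_c0 g \<longleftrightarrow> (\<lambda>n. apply_bcontfun f n - apply_bcontfun g n) \<longlonglongrightarrow> 0"
  by (simp add: linf_mod_c0.abs_eq_iff null_seqs_def minus_bcontfun.rep_eq)

text \<open>A representative \<open>g\<close> of norm below \<open>C\<close> differs from
  \<open>h\<close> by a null sequence, which eventually fits into the gap \<open>C - norm g\<close>.
  Together with \<open>norm_class_le_eventually\<close> this identifies the quotient norm with the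
  limit superior of the absolute values.\<close>

lemma eventually_abs_le_norm_class:
  assumes "norm (abs_linf_mod_c0 h) < C"
  shows "\<forall>\<^sub>F n in sequentially. \<bar>apply_bcontfun h n\<bar> \<le> C"
proof -
  obtain g where g: "abs_linf_mod_c0 g = abs_linf_mod_c0 h" "norm g < C"
    using norm_class_less[OF assms] by blast
  then have "(\<lambda>n. apply_bcontfun g n - apply_bcontfun h n) \<longlonglongrightarrow> 0" by (simp add: abs_linf_mod_c0_eq_iff)
  then have "\<forall>\<^sub>F n in sequentially. norm (apply_bcontfun g n - apply_bcontfun h n) < C - norm g"
    using g(2) by (auto simp: tendsto_iff)
  then show ?thesis
  proof (rule eventually_mono)
    fix n assume "norm (apply_bcontfun g n - apply_bcontfun h n) < C - norm g"
    then show "\<bar>apply_bcontfun h n\<bar> \<le> C" using norm_bounded[of g n] by simp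
  qed
qed

text \<open>Setting finitely many entries to 0 keeps the class and turns the eventual bound into a
  bound on the whole sequence.\<close>

lemma norm_class_le_eventually:
  assumes "\<forall>\<^sub>F n in sequentially. \<bar>apply_bcontfun h n\<bar> \<le> C"
  shows "norm (abs_linf_mod_c0 h) \<le> C"
proof -
  obtain m where m: "\<And>n. n \<ge> m \<Longrightarrow> \<bar>apply_bcontfun h n\<bar> \<le> C"
    using assms unfolding eventually_sequentially by blast
  have "0 \<le> C" using m[of m] by simp
  have b: "\<bar>if n < m then 0 else apply_bcontfun h n\<bar> \<le> C" for n
    using m[of n] \<open>0 \<le> C\<close> by (cases "n < m") auto
  obtain g :: linf where g: "apply_bcontfun g = (\<lambda>n. if n < m then 0 else apply_bcontfun h n)"
    using linf_of_bounded[of "\<lambda>n. if n < m then 0 else apply_bcontfun h n" C] b by blast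
  have "\<forall>\<^sub>F n in sequentially. apply_bcontfun h n - apply_bcontfun g n = 0"
    using eventually_ge_at_top[of m] by eventually_elim (simp add: g)
  then have "abs_linf_mod_c0 h = abs_linf_mod_c0 g"
    unfolding abs_linf_mod_c0_eq_iff by (rule tendsto_eventually)
  moreover have "norm g \<le> C" using b by (intro norm_bound) (simp add: g)
  ultimately show ?thesis using norm_class_le[of g] by simp
qed

lemma frequently_abs_gt_norm_class:
  assumes "C < norm (abs_linf_mod_c0 h)"
  obtains n where "m \<le> n" "C < \<bar>apply_bcontfun h n\<bar>"
proof -
  have "\<not> (\<forall>\<^sub>F n in sequentially. \<bar>apply_bcontfun h n\<bar> \<le> C)"
    using norm_class_le_eventually[of h C] assms by auto
  then show thesis using that unfolding eventually_sequentially by (meson not_le)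
qed

section \<open>Finitely supported rational rows\<close>

type_synonym row = "(nat \<times> rat) list"

text \<open>Rational entries and finite supports make the type \<open>row\<close> countable. This is
  what later divides the approximations of a matrix into countably many linked pieces.\<close>

definition row_val :: "row \<Rightarrow> (nat \<Rightarrow> real) \<Rightarrow> real"
  where "row_val r f = (\<Sum>(n, q)\<leftarrow>r. of_rat q * f n)"

text \<open>An upper bound for the \<open>\<ell>\<^sub>1\<close> norm of the functional
  \<open>row_val r\<close>, with equality when no index is repeated.\<close>

definition row_weight :: "row \<Rightarrow> real"
  where "row_weight r = (\<Sum>(n, q)\<leftarrow>r. \<bar>of_rat q\<bar>)"

lemma row_val_simps [simp]:
  "row_val [] f = 0" "row_val ((n, q) # r) f = of_rat q * f n + row_val r f"
  "row_val (r @ s) f = row_val r f + row_val s f"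
  by (simp_all add: row_val_def)

lemma row_weight_simps [simp]:
  "row_weight [] = 0" "row_weight ((n, q) # r) = \<bar>of_rat q\<bar> + row_weight r"
  "row_weight (r @ s) = row_weight r + row_weight s"
  by (simp_all add: row_weight_def)

lemma row_weight_nonneg: "0 \<le> row_weight r"
  by (induction r) auto

lemma row_val_add: "row_val r (\<lambda>n. f n + g n) = row_val r f + row_val r g"
  by (induction r) (auto simp: algebra_simps)

lemma row_val_diff: "row_val r (\<lambda>n. f n - g n) = row_val r f - row_val r g"
  by (induction r) (auto simp: algebra_simps)

lemma row_val_scale: "row_val r (\<lambda>n. c * f n) = c * row_val r f"
  by (induction r) (auto simp: algebra_simps)

lemma row_val_bound:
  assumes "\<And>x. x \<in> set r \<Longrightarrow> \<bar>f (fst x)\<bar> \<le> b"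
  shows "\<bar>row_val r f\<bar> \<le> row_weight r * b"
  using assms
proof (induction r)
  case (Cons x r)
  obtain n q where x: "x = (n, q)" by (cases x)
  have "\<bar>of_rat q * f n\<bar> \<le> \<bar>of_rat q\<bar> * b"
    using Cons.prems[of x] unfolding abs_mult by (intro mult_left_mono) (auto simp: x)
  moreover have "\<bar>row_val r f\<bar> \<le> row_weight r * b" using Cons by simp
  ultimately show ?case by (auto simp: x algebra_simps)
qed simp

definition row_scale :: "rat \<Rightarrow> row \<Rightarrow> row"
  where "row_scale t = map (\<lambda>(n, q). (n, t * q))"

lemma row_val_row_scale: "row_val (row_scale t r) f = of_rat t * row_val r f"
  unfolding row_scale_def by (induction r) (auto simp: algebra_simps of_rat_mult)

lemma row_weight_row_scale: "row_weight (row_scale t r) = \<bar>of_rat t\<bar> * row_weight r"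
  unfolding row_scale_def by (induction r) (auto simp: algebra_simps of_rat_mult abs_mult)

text \<open>The second condition amounts to each index occurring in only finitely many rows.\<close>

definition admissible :: "(nat \<Rightarrow> row) \<Rightarrow> bool"
  where "admissible \<rho> \<longleftrightarrow> (\<exists>M. \<forall>i. row_weight (\<rho> i) \<le> M) \<and>
    (\<forall>N. \<forall>\<^sub>F i in sequentially. \<forall>x\<in>set (\<rho> i). N \<le> fst x)"

text \<open>Admissible matrices map \<open>\<ell>\<^sub>\<infinity>\<close> to \<open>\<ell>\<^sub>\<infinity>\<close> and null sequences to null sequences, hence act on
  classes; for other matrices the value is junk.\<close>

definition matrix_op :: "(nat \<Rightarrow> row) \<Rightarrow> linf_mod_c0 \<Rightarrow> linf_mod_c0"
  where "matrix_op \<rho> x = abs_linf_mod_c0 (Bcontfun (\<lambda>i. row_val (\<rho> i) (apply_bcontfun (rep_linf_mod_c0 x))))"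

lemma row_val_le_norm: "row_weight r \<le> M \<Longrightarrow> \<bar>row_val r (apply_bcontfun f)\<bar> \<le> M * norm (f :: linf)"
proof -
  assume "row_weight r \<le> M"
  have "\<bar>row_val r (apply_bcontfun f)\<bar> \<le> row_weight r * norm f"
    by (rule row_val_bound) (use norm_bounded[of f] in simp)
  also have "\<dots> \<le> M * norm f" by (rule mult_right_mono) (use \<open>row_weight r \<le> M\<close> in auto)
  finally show ?thesis .
qed

lemma ex_rows:
  assumes "\<And>i. row_weight (\<rho> i) \<le> M"
  shows "\<exists>g :: linf. apply_bcontfun g = (\<lambda>i. row_val (\<rho> i) (apply_bcontfun (f :: linf)))"
  by (rule linf_of_bounded) (rule row_val_le_norm[OF assms])

text \<open>This frees \<open>matrix_op\<close> from the representative chosen in its definition: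
  two representatives differ by less than \<open>d\<close> beyond some \<open>N\<close>, almost all
  rows live beyond \<open>N\<close>, and there the images differ by at most
  \<open>M * d\<close>.\<close>

lemma matrix_op_class:
  assumes adm: "admissible \<rho>" and g: "apply_bcontfun g = (\<lambda>i. row_val (\<rho> i) (apply_bcontfun f))"
  shows "matrix_op \<rho> (abs_linf_mod_c0 f) = abs_linf_mod_c0 g"
proof -
  obtain M where M: "\<And>i. row_weight (\<rho> i) \<le> M" and supp: "\<And>N. \<forall>\<^sub>F i in sequentially. \<forall>x\<in>set (\<rho> i). N \<le> fst x"
    using adm unfolding admissible_def by blast
  have M0: "0 \<le> M" using M[of 0] row_weight_nonneg[of "\<rho> 0"] by simp
  define f' where "f' = rep_linf_mod_c0 (abs_linf_mod_c0 f)"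
  have "abs_linf_mod_c0 f' = abs_linf_mod_c0 f"
    unfolding f'_def by (rule Quotient3_abs_rep[OF Quotient3_linf_mod_c0])
  then have null: "(\<lambda>n. apply_bcontfun f' n - apply_bcontfun f n) \<longlonglongrightarrow> 0" by (simp add: abs_linf_mod_c0_eq_iff)
  obtain g' :: linf where g': "apply_bcontfun g' = (\<lambda>i. row_val (\<rho> i) (apply_bcontfun f'))"
    using ex_rows[of \<rho> M] M by blast
  have "(\<lambda>i. apply_bcontfun g' i - apply_bcontfun g i) \<longlonglongrightarrow> 0"
    unfolding tendsto_iff
  proof (intro allI impI)
    fix e :: real assume e: "0 < e"
    define d where "d = e / (M + 1)"
    have d: "0 < d" "M * d < e" using e M0 by (auto simp: d_def field_simps)
    from null d(1) obtain N where N: "\<And>n. n \<ge> N \<Longrightarrow> \<bar>apply_bcontfun f' n - apply_bcontfun f n\<bar> < d"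
      by (auto simp: LIMSEQ_iff)
    from supp[of N] show "\<forall>\<^sub>F i in sequentially. dist (apply_bcontfun g' i - apply_bcontfun g i) 0 < e"
    proof (rule eventually_mono)
      fix i assume i: "\<forall>x\<in>set (\<rho> i). N \<le> fst x"
      have "\<bar>row_val (\<rho> i) (\<lambda>n. apply_bcontfun f' n - apply_bcontfun f n)\<bar> \<le> row_weight (\<rho> i) * d"
        by (rule row_val_bound) (use i N in \<open>auto intro: less_imp_le\<close>)
      also have "\<dots> \<le> M * d" using M d(1) by (intro mult_right_mono) auto
      finally show "dist (apply_bcontfun g' i - apply_bcontfun g i) 0 < e"
        using d(2) by (simp add: g g' row_val_diff)
    qed
  qed
  then have "abs_linf_mod_c0 g' = abs_linf_mod_c0 g" by (simp add: abs_linf_mod_c0_eq_iff)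
  moreover have "Bcontfun (\<lambda>i. row_val (\<rho> i) (apply_bcontfun f')) = g'"
    unfolding g'[symmetric] by (rule apply_bcontfun_inverse)
  ultimately show ?thesis unfolding matrix_op_def f'_def by simp
qed

lemma bounded_linear_matrix_op:
  assumes adm: "admissible \<rho>"
  shows "bounded_linear (matrix_op \<rho>)"
proof -
  obtain M where M: "\<And>i. row_weight (\<rho> i) \<le> M" using adm unfolding admissible_def by blast
  have M0: "0 \<le> M" using M[of 0] row_weight_nonneg[of "\<rho> 0"] by simp
  have ex: "\<exists>g. apply_bcontfun g = (\<lambda>i. row_val (\<rho> i) (apply_bcontfun f)) \<and>
      matrix_op \<rho> (abs_linf_mod_c0 f) = abs_linf_mod_c0 g" for f :: linf
  proof -
    obtain g :: linf where g: "apply_bcontfun g = (\<lambda>i. row_val (\<rho> i) (apply_bcontfun f))"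
      using ex_rows[of \<rho> M] M by blast
    then show ?thesis using matrix_op_class[OF adm, of g f] by blast
  qed
  show ?thesis
  proof (rule bounded_linear_intro[of _ "M + 1"])
    fix x y :: linf_mod_c0 and c :: real
    obtain f g where x: "x = abs_linf_mod_c0 f" and y: "y = abs_linf_mod_c0 g" using linf_mod_c0_class by metis
    obtain f' where f': "apply_bcontfun f' = (\<lambda>i. row_val (\<rho> i) (apply_bcontfun f))" "matrix_op \<rho> x = abs_linf_mod_c0 f'"
      using ex x by blast
    obtain g' where g': "apply_bcontfun g' = (\<lambda>i. row_val (\<rho> i) (apply_bcontfun g))" "matrix_op \<rho> y = abs_linf_mod_c0 g'"
      using ex y by blast
    have "matrix_op \<rho> (abs_linf_mod_c0 (f + g)) = abs_linf_mod_c0 (f' + g')"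
      by (rule matrix_op_class[OF adm]) (simp add: fun_eq_iff plus_bcontfun.rep_eq f' g' flip: row_val_add)
    then show "matrix_op \<rho> (x + y) = matrix_op \<rho> x + matrix_op \<rho> y"
      unfolding f'(2) g'(2) by (simp add: x y plus_linf_mod_c0.abs_eq)
    have "matrix_op \<rho> (abs_linf_mod_c0 (c *\<^sub>R f)) = abs_linf_mod_c0 (c *\<^sub>R f')"
      by (rule matrix_op_class[OF adm]) (simp add: fun_eq_iff scaleR_bcontfun.rep_eq f' flip: row_val_scale)
    then show "matrix_op \<rho> (c *\<^sub>R x) = c *\<^sub>R matrix_op \<rho> x"
      unfolding f'(2) by (simp add: x scaleR_linf_mod_c0.abs_eq)
    show "norm (matrix_op \<rho> x) \<le> norm x * (M + 1)"
    proof (rule ccontr)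
      assume "\<not> ?thesis"
      \<comment> \<open>Using \<open>M + 1\<close> in place of \<open>M\<close> keeps the divisor
        positive.\<close>
      then have "norm x < norm (matrix_op \<rho> x) / (M + 1)" using M0 by (simp add: field_simps)
      then obtain h where h: "abs_linf_mod_c0 h = x" "norm h < norm (matrix_op \<rho> x) / (M + 1)"
        by (rule norm_class_less)
      obtain h' where h': "apply_bcontfun h' = (\<lambda>i. row_val (\<rho> i) (apply_bcontfun h))" "matrix_op \<rho> x = abs_linf_mod_c0 h'"
        using ex[of h] h(1) by auto
      have "norm h' \<le> (M + 1) * norm h"
      proof (rule norm_bound)
        show "norm (apply_bcontfun h' i) \<le> (M + 1) * norm h" for i
          unfolding h' real_norm_def by (rule row_val_le_norm) (use M[of i] in simp)
      qed
      also have "\<dots> < norm (matrix_op \<rho> x)" using h(2) M0 by (simp add: field_simps)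
      finally show False using norm_class_le[of h'] by (simp add: h'(2))
    qed
  qed
qed

section \<open>Restriction to a set and composition with a permutation\<close>

definition restr_op :: "nat set \<Rightarrow> linf_mod_c0 \<Rightarrow> linf_mod_c0"
  where "restr_op A = matrix_op (\<lambda>i. if i \<in> A then [(i, 1)] else [])"

definition comp_op :: "(nat \<Rightarrow> nat) \<Rightarrow> linf_mod_c0 \<Rightarrow> linf_mod_c0"
  where "comp_op \<pi> = matrix_op (\<lambda>i. [(\<pi> i, 1)])"

lemma admissible_restr: "admissible (\<lambda>i. if i \<in> A then [(i, 1)] else [])"
  unfolding admissible_def
proof (intro conjI allI)
  show "\<exists>M. \<forall>i. row_weight (if i \<in> A then [(i, 1)] else []) \<le> M" by (intro exI[of _ 1]) simp
  fix N :: nat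
  show "\<forall>\<^sub>F i in sequentially. \<forall>x\<in>set (if i \<in> A then [(i, 1 :: rat)] else []). N \<le> fst x"
    using eventually_ge_at_top[of N] by eventually_elim auto
qed

text \<open>Injectivity leaves only finitely many \<open>i\<close> with
  \<open>\<pi> i < N\<close>.\<close>

lemma admissible_comp: "inj \<pi> \<Longrightarrow> admissible (\<lambda>i. [(\<pi> i, 1)])"
  unfolding admissible_def
proof (intro conjI allI)
  show "\<exists>M. \<forall>i. row_weight [(\<pi> i, 1)] \<le> M" by (intro exI[of _ 1]) simp
  fix N :: nat assume "inj \<pi>"
  then have "\<forall>\<^sub>F i in sequentially. N \<le> \<pi> i"
    using finite_vimageI[OF finite_lessThan[of N], of \<pi>]
    by (simp add: cofinite_eq_sequentially[symmetric] eventually_cofinite vimage_def not_le)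
  then show "\<forall>\<^sub>F i in sequentially. \<forall>x\<in>set [(\<pi> i, 1 :: rat)]. N \<le> fst x" by simp
qed

lemmas bounded_linear_restr_op = bounded_linear_matrix_op[OF admissible_restr, folded restr_op_def]
lemmas bounded_linear_comp_op = bounded_linear_matrix_op[OF admissible_comp, folded comp_op_def]

lemma restr_op_class:
  "apply_bcontfun g = (\<lambda>i. if i \<in> A then apply_bcontfun f i else 0) \<Longrightarrow>
    restr_op A (abs_linf_mod_c0 f) = abs_linf_mod_c0 g"
  unfolding restr_op_def by (rule matrix_op_class[OF admissible_restr]) (auto simp: fun_eq_iff)

lemma comp_op_class:
  "inj \<pi> \<Longrightarrow> apply_bcontfun g = (\<lambda>i. apply_bcontfun f (\<pi> i)) \<Longrightarrow>
    comp_op \<pi> (abs_linf_mod_c0 f) = abs_linf_mod_c0 g"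
  unfolding comp_op_def by (rule matrix_op_class[OF admissible_comp]) simp_all

lemma ex_restr: "\<exists>g :: linf. apply_bcontfun g = (\<lambda>i. if i \<in> A then apply_bcontfun (f :: linf) i else 0)"
proof (rule linf_of_bounded)
  show "\<bar>if i \<in> A then apply_bcontfun f i else 0\<bar> \<le> norm f" for i
    using norm_bounded[of f i] by simp
qed

lemma ex_comp: "\<exists>g :: linf. apply_bcontfun g = (\<lambda>i. apply_bcontfun (f :: linf) (\<pi> i))"
proof (rule linf_of_bounded)
  show "\<bar>apply_bcontfun f (\<pi> i)\<bar> \<le> norm f" for i
    using norm_bounded[of f "\<pi> i"] by simp
qed

lemma restr_op_restr_op: "restr_op A (restr_op B x) = restr_op (A \<inter> B) x"
proof -
  obtain f where x: "x = abs_linf_mod_c0 f" by (rule linf_mod_c0_class)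
  obtain g where g: "apply_bcontfun g = (\<lambda>i. if i \<in> B then apply_bcontfun f i else 0)"
    using ex_restr by blast
  obtain h where h: "apply_bcontfun h = (\<lambda>i. if i \<in> A then apply_bcontfun g i else 0)"
    using ex_restr by blast
  have "restr_op (A \<inter> B) (abs_linf_mod_c0 f) = abs_linf_mod_c0 h"
    by (rule restr_op_class) (auto simp: fun_eq_iff g h)
  then show ?thesis by (simp add: x restr_op_class[of g B f, OF g] restr_op_class[of h A g, OF h])
qed

lemma restr_op_empty: "restr_op {} x = 0"
proof -
  obtain f where x: "x = abs_linf_mod_c0 f" by (rule linf_mod_c0_class)
  have "restr_op {} (abs_linf_mod_c0 f) = abs_linf_mod_c0 0" by (rule restr_op_class) (simp add: fun_eq_iff)
  then show ?thesis by (simp add: x zero_linf_mod_c0.abs_eq)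
qed

lemma restr_op_Compl: "restr_op A x + restr_op (- A) x = x"
proof -
  obtain f where x: "x = abs_linf_mod_c0 f" by (rule linf_mod_c0_class)
  obtain g where g: "apply_bcontfun g = (\<lambda>i. if i \<in> A then apply_bcontfun f i else 0)"
    using ex_restr by blast
  obtain h where h: "apply_bcontfun h = (\<lambda>i. if i \<in> - A then apply_bcontfun f i else 0)"
    using ex_restr by blast
  have "g + h = f" by (rule bcontfun_eqI) (simp add: plus_bcontfun.rep_eq g h)
  then show ?thesis
    by (simp add: x restr_op_class[of g A f, OF g] restr_op_class[of h "- A" f, OF h] plus_linf_mod_c0.abs_eq)
qed

text \<open>This tracks supports: a class that vanishes on \<open>A\<close> is carried to one that
  vanishes on the preimage of \<open>A\<close>.\<close>

lemma comp_op_restr_op: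
  assumes "inj \<pi>"
  shows "comp_op \<pi> (restr_op A x) = restr_op (\<pi> -` A) (comp_op \<pi> x)"
proof -
  obtain f where x: "x = abs_linf_mod_c0 f" by (rule linf_mod_c0_class)
  obtain g where g: "apply_bcontfun g = (\<lambda>i. if i \<in> A then apply_bcontfun f i else 0)"
    using ex_restr by blast
  obtain h where h: "apply_bcontfun h = (\<lambda>i. apply_bcontfun f (\<pi> i))" using ex_comp by blast
  obtain k where k: "apply_bcontfun k = (\<lambda>i. apply_bcontfun g (\<pi> i))" using ex_comp by blast
  have "restr_op (\<pi> -` A) (abs_linf_mod_c0 h) = abs_linf_mod_c0 k"
    by (rule restr_op_class) (auto simp: fun_eq_iff g h k)
  then show ?thesis
    by (simp add: x restr_op_class[of g A f, OF g] comp_op_class[OF assms, of h f, OF h] comp_op_class[OF assms, of k g, OF k])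
qed

lemma comp_op_comp_op:
  assumes "inj \<pi>" "inj \<sigma>" "\<And>i. \<sigma> (\<pi> i) = i"
  shows "comp_op \<pi> (comp_op \<sigma> x) = x"
proof -
  obtain f where x: "x = abs_linf_mod_c0 f" by (rule linf_mod_c0_class)
  obtain h where h: "apply_bcontfun h = (\<lambda>i. apply_bcontfun f (\<sigma> i))" using ex_comp by blast
  have "comp_op \<pi> (abs_linf_mod_c0 h) = abs_linf_mod_c0 f"
    by (rule comp_op_class[OF assms(1)]) (simp add: h assms(3) fun_eq_iff)
  then show ?thesis by (simp add: x comp_op_class[OF assms(2), of h f, OF h])
qed

section \<open>Splitting an embedding\<close>

lemma order_filter_directed:
  "order_filter P r G \<Longrightarrow> p \<in> G \<Longrightarrow> q \<in> G \<Longrightarrow> \<exists>s\<in>G. (s, p) \<in> r \<and> (s, q) \<in> r"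
  by (simp add: order_filter_def)

text \<open>The conditions are finite 0-1 sequences, a countable order, so singletons serve as
  linked pieces. Genericity puts into \<open>A\<close> arbitrarily late positions at which a
  representative of \<open>J (rat_comb xs)\<close> exceeds
  \<open>c / 2 * norm (rat_comb xs)\<close>. This gives the bound for rational combinations, and
  density gives it for all \<open>v\<close>.\<close>

lemma splitting_set:
  fixes J :: "'k c0 \<Rightarrow> linf_mod_c0"
  assumes inf: "infinite (UNIV :: 'k set)" and MA: "MA_sigma_linked TYPE('k)"
    and J: "bounded_linear J" and c: "0 < c" "\<And>v. c * norm v \<le> norm (J v)"
  obtains A where "infinite A" "infinite (- A)" "\<And>v. c / 2 * norm v \<le> norm (restr_op A (J v))"
proof -
  have "\<exists>h. J (rat_comb xs) = abs_linf_mod_c0 h" for xs by (metis linf_mod_c0_class)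
  then obtain h where h: "\<And>xs. J (rat_comb xs) = abs_linf_mod_c0 (h xs)" by metis
  define r :: "bool list rel" where "r = {(t @ u, t) |t u. True}"
  define good where "good xs n \<longleftrightarrow> c / 2 * norm (rat_comb xs) < \<bar>apply_bcontfun (h xs) n\<bar>" for xs n
  define D :: "('k \<times> rat) list \<times> nat \<Rightarrow> bool list set" where
    "D = (\<lambda>(xs, m). {s. (rat_comb xs \<noteq> 0 \<longrightarrow> (\<exists>n\<ge>m. n < length s \<and> s ! n \<and> good xs n)) \<and>
        (\<exists>n\<ge>m. n < length s \<and> \<not> s ! n)})"
  have "partial_order_on UNIV r"
    unfolding partial_order_on_def preorder_on_def
    by (auto simp: refl_on_def r_def intro!: transI antisymI)
  moreover have "sigma_linked UNIV r"
    unfolding sigma_linked_def compatible_in_def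
  proof (intro exI[of _ "\<lambda>n. {from_nat n}"] conjI allI ballI)
    show "UNIV = (\<Union>n. {from_nat n :: bool list})" using surj_from_nat by (simp add: UNION_singleton_eq_range)
    show "\<exists>s\<in>UNIV. (s, p) \<in> r \<and> (s, q) \<in> r" if "p \<in> {from_nat n}" "q \<in> {from_nat n}" for n p q
      using that by (intro bexI[of _ p]) (auto simp: r_def)
  qed
  moreover have "order_dense UNIV r (D i)" for i
  proof -
    obtain xs m where i: "i = (xs, m)" by (cases i)
    have "\<exists>d\<in>D i. (d, t) \<in> r" for t
    proof -
      have "\<exists>n\<ge>max m (length t). rat_comb xs \<noteq> 0 \<longrightarrow> good xs n"
      proof (cases "rat_comb xs = 0")
        case False
        then have "0 < c * norm (rat_comb xs)" using c(1) by simp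
        then have "c / 2 * norm (rat_comb xs) < norm (abs_linf_mod_c0 (h xs))"
          using c(2)[of "rat_comb xs"] by (simp add: h)
        then show ?thesis unfolding good_def by (meson frequently_abs_gt_norm_class)
      qed (auto intro: exI[of _ "max m (length t)"])
      then obtain n where n: "m \<le> n" "length t \<le> n" "rat_comb xs \<noteq> 0 \<longrightarrow> good xs n" by auto
      \<comment> \<open>Beyond \<open>t\<close>, the sequence is padded with \<open>False\<close> up
        to the good position \<open>n\<close>; then \<open>n\<close> is put into \<open>A\<close>
        and \<open>Suc n\<close> is kept out, which serves both clauses of \<open>D\<close>.\<close>
      define s where "s = t @ replicate (n - length t) False @ [True, False]"
      have "s ! n" "\<not> s ! Suc n" "length s = n + 2"
        using n(2) by (auto simp: s_def nth_append)
      moreover have "n < n + 2" "Suc n < n + 2" "m \<le> Suc n" using n(1) by auto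
      ultimately have "s \<in> D i" using n(1,3) unfolding D_def i mem_Collect_eq prod.case by metis
      moreover have "(s, t) \<in> r" by (auto simp: s_def r_def)
      ultimately show ?thesis by blast
    qed
    then show ?thesis by (simp add: order_dense_def)
  qed
  moreover have "|UNIV :: (('k \<times> rat) list \<times> nat) set| \<le>o |UNIV :: 'k set|"
    by (intro card_of_prod_ordLeq card_of_lists_ordLeq card_of_countable_ordLeq inf) (rule card_of_mono1, simp)
  ultimately obtain G where G: "order_filter UNIV r G" and GD: "\<And>i. G \<inter> D i \<noteq> {}"
    using MA_sigma_linked_filter[OF inf MA, of UNIV r D] by blast
  define A where "A = {n. \<exists>s\<in>G. n < length s \<and> s ! n}"
  \<comment> \<open>The conditions in \<open>G\<close> do not contradict each other: any two are
    initial segments of a common third.\<close>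
  have A: "n \<in> A \<longleftrightarrow> s ! n" if s: "s \<in> G" "n < length s" for s n
  proof
    assume "n \<in> A"
    then obtain t where t: "t \<in> G" "n < length t" "t ! n" by (auto simp: A_def)
    obtain u where "(u, s) \<in> r" "(u, t) \<in> r" using order_filter_directed[OF G s(1) t(1)] by blast
    then obtain x y where "u = s @ x" "u = t @ y" unfolding r_def by blast
    then have "u ! n = s ! n" "u ! n = t ! n" using t(2) s(2) by (metis nth_append)+
    then show "s ! n" using t(3) by simp
  qed (use s in \<open>auto simp: A_def\<close>)
  have good_A: "\<exists>n\<ge>m. n \<in> A \<and> good xs n" if "rat_comb xs \<noteq> 0" for xs m
  proof -
    obtain s where s: "s \<in> G" "s \<in> D (xs, m)" using GD by blast
    then show ?thesis using A[OF s(1)] that by (auto simp: D_def)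
  qed
  have not_A: "\<exists>n\<ge>m. n \<notin> A" for m
  proof -
    obtain s where s: "s \<in> G" "s \<in> D ([], m)" using GD by blast
    then show ?thesis using A[OF s(1)] by (auto simp: D_def)
  qed
  show thesis
  proof
    \<comment> \<open>Any unit vector is a nonzero combination, and its good positions make
      \<open>A\<close> unbounded.\<close>
    obtain k :: 'k where True by simp
    have "rat_comb [(k, 1)] \<noteq> (0 :: 'k c0)"
    proof
      assume "rat_comb [(k, 1)] = (0 :: 'k c0)"
      then have "c0_apply (c0_unit k) k = c0_apply 0 k" by (simp add: rat_comb_def)
      then show False by (simp add: c0_unit.rep_eq zero_c0.rep_eq)
    qed
    then show "infinite A" using good_A unfolding infinite_nat_iff_unbounded_le by blast
    show "infinite (- A)" using not_A unfolding infinite_nat_iff_unbounded_le by auto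
    have "c / 2 * norm (rat_comb xs) \<le> norm (restr_op A (J (rat_comb xs)))" for xs
    proof (cases "rat_comb xs = 0")
      case False
      obtain g where g: "apply_bcontfun g = (\<lambda>i. if i \<in> A then apply_bcontfun (h xs) i else 0)"
        using ex_restr by blast
      have eq: "restr_op A (J (rat_comb xs)) = abs_linf_mod_c0 g" unfolding h by (rule restr_op_class[OF g])
      show ?thesis
      proof (rule ccontr)
        assume "\<not> ?thesis"
        then have "\<forall>\<^sub>F n in sequentially. \<bar>apply_bcontfun g n\<bar> \<le> c / 2 * norm (rat_comb xs)"
          by (intro eventually_abs_le_norm_class) (simp add: eq)
        then obtain m where m: "\<And>n. n \<ge> m \<Longrightarrow> \<bar>apply_bcontfun g n\<bar> \<le> c / 2 * norm (rat_comb xs)"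
          unfolding eventually_sequentially by blast
        obtain n where "m \<le> n" "n \<in> A" "good xs n" using good_A[OF False] by blast
        then show False using m[of n] by (simp add: g good_def)
      qed
    qed simp
    then have "range rat_comb \<subseteq> {v. c / 2 * norm v \<le> norm (restr_op A (J v))}" by auto
    moreover have "closed {v. c / 2 * norm v \<le> norm (restr_op A (J v))}"
    proof (rule closed_Collect_le)
      show "continuous_on UNIV (\<lambda>v. norm (restr_op A (J v)))"
        by (intro continuous_on_norm linear_continuous_on bounded_linear_compose[OF bounded_linear_restr_op J])
    qed (intro continuous_intros)
    ultimately have "closure (range rat_comb) \<subseteq> {v. c / 2 * norm v \<le> norm (restr_op A (J v))}"
      by (rule closure_minimal)
    then show "c / 2 * norm v \<le> norm (restr_op A (J v))" for v by (auto simp: closure_rat_comb)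
  qed
qed

section \<open>Factorization through an embedding\<close>

text \<open>If the distance from \<open>b\<close> to \<open>S\<close> were positive, then moving from a nearly closest \<open>u\<close> a little towards
  the \<open>v\<close> provided by \<open>sup\<close> for \<open>a = b - u\<close> would come closer than this distance.\<close>

lemma approx_in_convex:
  fixes S :: "('a \<Rightarrow> real) set" and b :: "'a \<Rightarrow> real"
  assumes F: "finite F" and ne: "S \<noteq> {}" and bnd: "\<And>u k. u \<in> S \<Longrightarrow> k \<in> F \<Longrightarrow> \<bar>u k\<bar> \<le> R"
    and conv: "\<And>u v n. u \<in> S \<Longrightarrow> v \<in> S \<Longrightarrow> (\<lambda>k. u k + 1 / real (Suc n) * (v k - u k)) \<in> S"
    and sup: "\<And>a. \<exists>v\<in>S. (\<Sum>k\<in>F. a k * b k) \<le> (\<Sum>k\<in>F. a k * v k)"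
    and e: "0 < e"
  shows "\<exists>u\<in>S. \<forall>k\<in>F. \<bar>u k - b k\<bar> \<le> e"
proof -
  define Q where "Q u = (\<Sum>k\<in>F. (b k - u k)\<^sup>2)" for u
  have Q0: "0 \<le> Q u" for u by (simp add: Q_def sum_nonneg)
  have bdd: "bdd_below (Q ` S)" by (rule bdd_belowI2[of _ 0]) (rule Q0)
  define d where "d = (INF u\<in>S. Q u)"
  have d_le: "d \<le> Q u" if "u \<in> S" for u unfolding d_def by (rule cINF_lower[OF bdd that])
  have near: "\<exists>u\<in>S. Q u < t" if "d < t" for t
    using that unfolding d_def by (subst (asm) cINF_less_iff[OF ne bdd])
  have "d \<le> 0"
  proof (rule ccontr)
    assume "\<not> d \<le> 0"
    then have d: "0 < d" by simp
    define C where "C = (\<Sum>k\<in>F. (2 * R)\<^sup>2)"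
    have C0: "0 \<le> C" by (simp add: C_def sum_nonneg)
    \<comment> \<open>The step length \<open>t\<close> has the form offered by \<open>conv\<close>
      and is so small that the errors \<open>t\<^sup>2 * (1 + C)\<close> stay below the first-order
      gain \<open>2 * t * d\<close>. One \<open>t\<^sup>2\<close> pays for \<open>u\<close> being
      only nearly closest, and \<open>t\<^sup>2 * C\<close> for the quadratic term.\<close>
    obtain n where n: "(1 + C) / (2 * d) < real n" using reals_Archimedean2 by blast
    define t where "t = 1 / real (Suc n)"
    have t: "0 < t" "t * (1 + C) < 2 * d"
    proof -
      show "0 < t" by (simp add: t_def)
      have "1 + C < real n * (2 * d)" using n d by (simp add: field_simps)
      also have "\<dots> \<le> real (Suc n) * (2 * d)" using d by (intro mult_right_mono) auto
      finally show "t * (1 + C) < 2 * d" by (simp add: t_def field_simps)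
    qed
    obtain u where u: "u \<in> S" "Q u < d + t\<^sup>2" using near[of "d + t\<^sup>2"] t(1) by auto
    obtain v where v: "v \<in> S" "(\<Sum>k\<in>F. (b k - u k) * b k) \<le> (\<Sum>k\<in>F. (b k - u k) * v k)"
      using sup[of "\<lambda>k. b k - u k"] by blast
    define w where "w = (\<lambda>k. u k + t * (v k - u k))"
    have "w \<in> S" unfolding w_def t_def by (rule conv[OF u(1) v(1)])
    have "(\<Sum>k\<in>F. (v k - u k)\<^sup>2) \<le> C" unfolding C_def
    proof (rule sum_mono)
      fix k assume "k \<in> F"
      then have "\<bar>v k - u k\<bar> \<le> 2 * R" using bnd[OF u(1), of k] bnd[OF v(1), of k] by linarith
      then have "\<bar>v k - u k\<bar>\<^sup>2 \<le> (2 * R)\<^sup>2" by (intro power_mono) auto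
      then show "(v k - u k)\<^sup>2 \<le> (2 * R)\<^sup>2" by simp
    qed
    moreover have "Q w = Q u - 2 * t * (\<Sum>k\<in>F. (b k - u k) * (v k - u k)) + t\<^sup>2 * (\<Sum>k\<in>F. (v k - u k)\<^sup>2)"
      unfolding Q_def w_def
      by (simp add: sum_distrib_left sum.distrib[symmetric] sum_subtractf[symmetric])
        (rule sum.cong[OF refl], simp add: power2_eq_square algebra_simps)
    \<comment> \<open>In the direction \<open>b - u\<close>, the point \<open>v\<close> reaches at
      least as far as \<open>b\<close>. Hence a step from \<open>u\<close> towards \<open>v\<close>
      lowers \<open>Q\<close> at first order by at least \<open>2 * t * Q u\<close>.\<close>
    moreover have "Q u \<le> (\<Sum>k\<in>F. (b k - u k) * (v k - u k))"
    proof -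
      have "Q u = (\<Sum>k\<in>F. (b k - u k) * b k) - (\<Sum>k\<in>F. (b k - u k) * u k)"
        unfolding Q_def sum_subtractf[symmetric]
        by (rule sum.cong[OF refl]) (simp add: power2_eq_square algebra_simps)
      also have "\<dots> \<le> (\<Sum>k\<in>F. (b k - u k) * v k) - (\<Sum>k\<in>F. (b k - u k) * u k)" using v(2) by simp
      also have "\<dots> = (\<Sum>k\<in>F. (b k - u k) * (v k - u k))"
        by (simp add: sum_subtractf right_diff_distrib)
      finally show ?thesis .
    qed
    then have "2 * t * d \<le> 2 * t * (\<Sum>k\<in>F. (b k - u k) * (v k - u k))"
      using d_le[OF u(1)] t(1) by (intro mult_left_mono) auto
    moreover have "t\<^sup>2 * (\<Sum>k\<in>F. (v k - u k)\<^sup>2) \<le> t\<^sup>2 * C"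
      using calculation(1) by (intro mult_left_mono) auto
    ultimately have "2 * t * d \<le> t\<^sup>2 + t\<^sup>2 * C" using d_le[OF \<open>w \<in> S\<close>] u(2) by linarith
    then have "t * (2 * d) \<le> t * (t * (1 + C))" by (simp add: power2_eq_square algebra_simps)
    then have "2 * d \<le> t * (1 + C)" using t(1) by (rule mult_left_le_imp_le)
    then show False using t(2) by simp
  qed
  then obtain u where u: "u \<in> S" "Q u < e\<^sup>2" using near[of "e\<^sup>2"] e by (auto simp: le_less_trans)
  have "\<bar>u k - b k\<bar> \<le> e" if "k \<in> F" for k
  proof -
    have "(b k - u k)\<^sup>2 \<le> Q u" unfolding Q_def by (rule member_le_sum[OF that _ F]) simp
    then have "(u k - b k)\<^sup>2 \<le> e\<^sup>2" using u(2) by (simp add: power2_commute)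
    then show ?thesis using e by (metis abs_le_square_iff abs_of_pos)
  qed
  then show ?thesis using u(1) by blast
qed

lemma apply_bcontfun_sum:
  "apply_bcontfun (\<Sum>k\<in>F. a k *\<^sub>R (g k :: linf)) n = (\<Sum>k\<in>F. a k * apply_bcontfun (g k) n)"
  by (induction F rule: infinite_finite_induct)
    (simp_all add: plus_bcontfun.rep_eq scaleR_bcontfun.rep_eq)

lemma sum_units_class:
  assumes "bounded_linear K" "\<And>k. K (c0_unit k) = abs_linf_mod_c0 (g k)"
  shows "K (\<Sum>k\<in>F. a k *\<^sub>R c0_unit k) = abs_linf_mod_c0 (\<Sum>k\<in>F. a k *\<^sub>R g k)"
proof -
  interpret K: bounded_linear K by fact
  interpret Q: bounded_linear abs_linf_mod_c0 by (rule bounded_linear_abs_linf_mod_c0)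
  show ?thesis by (simp add: K.sum K.scaleR Q.sum Q.scaleR assms(2))
qed

text \<open>A combination of unit vectors with signs has norm at most 1, so its image is eventually
  bounded by \<open>B + 1\<close>. For finite \<open>F\<close> there are finitely many sign
  patterns, so eventually all these bounds hold together. The constant does not depend on
  \<open>F\<close>.\<close>

lemma sum_abs_eventually_le:
  fixes K :: "'k c0 \<Rightarrow> linf_mod_c0"
  assumes K: "bounded_linear K" and g: "\<And>k. K (c0_unit k) = abs_linf_mod_c0 (g k)"
  obtains C where "0 < C"
    "\<And>F. finite F \<Longrightarrow> \<forall>\<^sub>F n in sequentially. (\<Sum>k\<in>F. \<bar>apply_bcontfun (g k) n\<bar>) \<le> C"
proof -
  obtain B where B: "0 < B" "\<And>v. norm (K v) \<le> norm v * B"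
    using bounded_linear.pos_bounded[OF K] by blast
  show thesis
  proof
    show "0 < B + 1" using B(1) by simp
    fix F :: "'k set" assume F: "finite F"
    define sg :: "'k set \<Rightarrow> 'k \<Rightarrow> real" where "sg S k = (if k \<in> S then 1 else - 1)" for S k
    have "\<forall>\<^sub>F n in sequentially. \<bar>\<Sum>k\<in>F. sg S k * apply_bcontfun (g k) n\<bar> \<le> B + 1" for S
    proof -
      have "norm (\<Sum>k\<in>F. sg S k *\<^sub>R c0_unit k) \<le> 1"
        by (rule c0_norm_le) (simp add: c0_apply_sum_units[OF F] sg_def)
      then have "norm (K (\<Sum>k\<in>F. sg S k *\<^sub>R c0_unit k)) < B + 1"
        using B(2)[of "\<Sum>k\<in>F. sg S k *\<^sub>R c0_unit k"] B(1)
        by (smt (verit) mult_left_le_one_le norm_ge_zero)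
      then show ?thesis
        unfolding sum_units_class[OF K g] apply_bcontfun_sum[symmetric] by (rule eventually_abs_le_norm_class)
    qed
    then have "\<forall>\<^sub>F n in sequentially. \<forall>S\<in>Pow F. \<bar>\<Sum>k\<in>F. sg S k * apply_bcontfun (g k) n\<bar> \<le> B + 1"
      using F by (intro eventually_ball_finite) auto
    then show "\<forall>\<^sub>F n in sequentially. (\<Sum>k\<in>F. \<bar>apply_bcontfun (g k) n\<bar>) \<le> B + 1"
    proof (rule eventually_mono)
      fix n assume n: "\<forall>S\<in>Pow F. \<bar>\<Sum>k\<in>F. sg S k * apply_bcontfun (g k) n\<bar> \<le> B + 1"
      \<comment> \<open>The sign pattern may depend on \<open>n\<close>: here it matches the signs
        of the entries at \<open>n\<close>, which produces the absolute values.\<close>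
      define S where "S = {k\<in>F. 0 \<le> apply_bcontfun (g k) n}"
      have "(\<Sum>k\<in>F. \<bar>apply_bcontfun (g k) n\<bar>) = (\<Sum>k\<in>F. sg S k * apply_bcontfun (g k) n)"
        by (rule sum.cong) (auto simp: sg_def S_def)
      moreover have "S \<in> Pow F" by (auto simp: S_def)
      ultimately show "(\<Sum>k\<in>F. \<bar>apply_bcontfun (g k) n\<bar>) \<le> B + 1" using n by (metis abs_ge_self order_trans)
    qed
  qed
qed

text \<open>By the lower bound on \<open>J\<close>, the vectors \<open>(f\<^sub>k(n))\<^sub>k\<^sub>\<in>\<^sub>F\<close> with \<open>n \<ge> N\<close> and their negatives are not
  separated from \<open>b/M\<close> by any linear functional on \<open>\<real>\<^sup>F\<close>.\<close>

lemma row_approx: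
  fixes J :: "'k c0 \<Rightarrow> linf_mod_c0" and M :: nat
  assumes J: "bounded_linear J" and f: "\<And>k. J (c0_unit k) = abs_linf_mod_c0 (f k)"
    and c: "0 < c" "\<And>v. c * norm v \<le> norm (J v)"
    and F: "finite F" and b: "(\<Sum>k\<in>F. \<bar>b k\<bar>) \<le> B" and M: "2 * B \<le> c * real M" and e: "0 < e"
  shows "\<exists>r. row_weight r \<le> real M \<and> (\<forall>x\<in>set r. N \<le> fst x) \<and>
    (\<forall>k\<in>F. \<bar>row_val r (apply_bcontfun (f k)) - b k\<bar> \<le> e)"
proof -
  define R where "R = {r. row_weight r \<le> real M \<and> (\<forall>x\<in>set r. N \<le> fst x)}"
  define val where "val r k = row_val r (apply_bcontfun (f k))" for r k
  have "\<exists>u\<in>val ` R. \<forall>k\<in>F. \<bar>u k - b k\<bar> \<le> e"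
  proof (rule approx_in_convex[OF F])
    have "[] \<in> R" by (simp add: R_def)
    then show "val ` R \<noteq> {}" by blast
  next
    fix u k assume "u \<in> val ` R" "k \<in> F"
    then obtain r where r: "r \<in> R" "u = val r" by blast
    have "\<bar>u k\<bar> \<le> real M * norm (f k)"
      using r row_val_le_norm[of r "real M" "f k"] by (simp add: R_def val_def)
    also have "norm (f k) \<le> (\<Sum>k\<in>F. norm (f k))"
      by (rule member_le_sum[OF \<open>k \<in> F\<close> _ F]) simp
    finally show "\<bar>u k\<bar> \<le> real M * (\<Sum>k\<in>F. norm (f k))" by (simp add: mult_left_mono)
  next
    fix u v and n :: nat assume "u \<in> val ` R" "v \<in> val ` R"
    then obtain p q where p: "p \<in> R" "u = val p" and q: "q \<in> R" "v = val q" by blast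
    define t :: rat where "t = 1 / of_nat (Suc n)"
    have t: "real_of_rat t = 1 / real (Suc n)" by (simp add: t_def of_rat_divide of_rat_add)
    have t01: "0 \<le> real_of_rat t" "real_of_rat t \<le> 1" unfolding t by simp_all
    \<comment> \<open>Concatenation adds the functionals as well as the weights, so \<open>w\<close>
      realizes a convex combination of \<open>p\<close> and \<open>q\<close>; its rational weights
      keep it a row.\<close>
    define w where "w = row_scale (1 - t) p @ row_scale t q"
    have "row_weight w = (1 - real_of_rat t) * row_weight p + real_of_rat t * row_weight q"
      using t01 by (simp add: w_def row_weight_row_scale of_rat_diff)
    also have "\<dots> \<le> (1 - real_of_rat t) * real M + real_of_rat t * real M"
      using p q t01 by (intro add_mono mult_left_mono) (auto simp: R_def)
    finally have "row_weight w \<le> real M" by (simp add: algebra_simps)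
    then have "w \<in> R" using p q by (auto simp: R_def w_def row_scale_def)
    moreover have "val w = (\<lambda>k. u k + 1 / real (Suc n) * (v k - u k))"
      unfolding t[symmetric] by (auto simp: val_def w_def row_val_row_scale p q of_rat_diff algebra_simps)
    ultimately show "(\<lambda>k. u k + 1 / real (Suc n) * (v k - u k)) \<in> val ` R" by (metis imageI)
  next
    fix a :: "'k \<Rightarrow> real"
    define v where "v = (\<Sum>k\<in>F. a k *\<^sub>R c0_unit k)"
    have a_le: "\<bar>a k\<bar> \<le> norm v" if "k \<in> F" for k
      using c0_abs_le_norm[of v k] that by (simp add: v_def c0_apply_sum_units[OF F])
    have "\<exists>n\<ge>N. c / 2 * norm v \<le> \<bar>\<Sum>k\<in>F. a k * apply_bcontfun (f k) n\<bar>"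
    proof (cases "v = 0")
      case False
      then have "0 < c * norm v" using c(1) by simp
      then have "c / 2 * norm v < norm (J v)" using c(2)[of v] by simp
      then have "c / 2 * norm v < norm (abs_linf_mod_c0 (\<Sum>k\<in>F. a k *\<^sub>R f k))"
        unfolding v_def sum_units_class[OF J f] .
      then obtain n where "N \<le> n" "c / 2 * norm v < \<bar>apply_bcontfun (\<Sum>k\<in>F. a k *\<^sub>R f k) n\<bar>"
        by (rule frequently_abs_gt_norm_class)
      then show ?thesis by (auto simp: apply_bcontfun_sum)
    qed auto
    then obtain n where n: "N \<le> n" "c / 2 * norm v \<le> \<bar>\<Sum>k\<in>F. a k * apply_bcontfun (f k) n\<bar>" by blast
    define s :: rat where "s = (if 0 \<le> (\<Sum>k\<in>F. a k * apply_bcontfun (f k) n) then of_nat M else - of_nat M)"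
    have "[(n, s)] \<in> R" using n(1) by (simp add: R_def s_def of_rat_minus)
    have "(\<Sum>k\<in>F. a k * b k) \<le> (\<Sum>k\<in>F. norm v * \<bar>b k\<bar>)"
    proof (rule sum_mono)
      fix k assume "k \<in> F"
      have "a k * b k \<le> \<bar>a k\<bar> * \<bar>b k\<bar>" by (metis abs_ge_self abs_mult)
      also have "\<dots> \<le> norm v * \<bar>b k\<bar>" by (intro mult_right_mono a_le \<open>k \<in> F\<close>) simp
      finally show "a k * b k \<le> norm v * \<bar>b k\<bar>" .
    qed
    also have "\<dots> = norm v * (\<Sum>k\<in>F. \<bar>b k\<bar>)" by (simp add: sum_distrib_left)
    also have "\<dots> \<le> norm v * (c * real M / 2)" using b M by (intro mult_left_mono) auto
    also have "\<dots> = real M * (c / 2 * norm v)" by simp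
    also have "\<dots> \<le> real M * \<bar>\<Sum>k\<in>F. a k * apply_bcontfun (f k) n\<bar>" using n(2) by (intro mult_left_mono) auto
    also have "\<dots> = of_rat s * (\<Sum>k\<in>F. a k * apply_bcontfun (f k) n)" by (simp add: s_def of_rat_minus)
    also have "\<dots> = (\<Sum>k\<in>F. a k * val [(n, s)] k)" by (simp add: val_def sum_distrib_left mult.left_commute)
    finally show "\<exists>u\<in>val ` R. (\<Sum>k\<in>F. a k * b k) \<le> (\<Sum>k\<in>F. a k * u k)"
      using \<open>[(n, s)] \<in> R\<close> by blast
  qed (rule e)
  then show ?thesis by (auto simp: R_def val_def)
qed

text \<open>A condition consists of the first rows of a matrix and a promise \<open>(F, N)\<close>: all further rows
  map \<open>f\<^sub>k\<close> to \<open>g\<^sub>k\<close> up to \<open>1/(N+1)\<close> for \<open>k \<in> F\<close> and are supported beyond \<open>N\<close>. Two conditions with the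
  same rows and the same \<open>N\<close> are compatible because \<open>\<Sum>\<^sub>k |g\<^sub>k(i)|\<close> over the union of the two sets \<open>F\<close> is at most
  \<open>2 C\<close> for all further \<open>i\<close>, and at most \<open>C\<close> from some \<open>i\<close> on.\<close>

lemma operator_through_embedding:
  fixes J K :: "'k c0 \<Rightarrow> linf_mod_c0"
  assumes inf: "infinite (UNIV :: 'k set)" and MA: "MA_sigma_linked TYPE('k)"
    and J: "bounded_linear J" and c: "0 < c" "\<And>v. c * norm v \<le> norm (J v)" and K: "bounded_linear K"
  shows "\<exists>U. bounded_linear U \<and> (\<forall>v. U (J v) = K v)"
proof -
  have "\<exists>f. J (c0_unit k) = abs_linf_mod_c0 f" for k by (metis linf_mod_c0_class)
  then obtain f where f: "\<And>k. J (c0_unit k) = abs_linf_mod_c0 (f k)" by metis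
  have "\<exists>g. K (c0_unit k) = abs_linf_mod_c0 g" for k by (metis linf_mod_c0_class)
  then obtain g where g: "\<And>k. K (c0_unit k) = abs_linf_mod_c0 (g k)" by metis
  obtain C where C: "0 < C"
    "\<And>F. finite F \<Longrightarrow> \<forall>\<^sub>F n in sequentially. (\<Sum>k\<in>F. \<bar>apply_bcontfun (g k) n\<bar>) \<le> C"
    using sum_abs_eventually_le[OF K g] by blast
  \<comment> \<open>The weight bound is chosen for absolute sums up to \<open>2 * C\<close>, because
    the union of two promised sets has to be served.\<close>
  obtain M :: nat where "4 * C / c < real M" using reals_Archimedean2 by blast
  then have M: "2 * (2 * C) \<le> c * real M" using c(1) by (simp add: field_simps)
  define fits where "fits F N r i \<longleftrightarrow> (\<forall>k\<in>F. \<bar>row_val r (apply_bcontfun (f k)) - apply_bcontfun (g k) i\<bar> \<le> 1 / real (Suc N))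
      \<and> (\<forall>x\<in>set r. N \<le> fst x)" for F N r i
  have fits_mono: "fits F N r i" if "fits F' N' r i" "F \<subseteq> F'" "N \<le> N'" for F F' N N' r i
  proof -
    have "1 / real (Suc N') \<le> 1 / real (Suc N)" using that(3) by (intro divide_left_mono) auto
    then show ?thesis using that unfolding fits_def by (meson order_trans subsetD)
  qed
  \<comment> \<open>The bound on the tail sums guarantees that the promise can be kept by all
    further rows.\<close>
  define P where "P = {(\<rho>, F :: 'k set, N :: nat). finite F \<and> (\<forall>r\<in>set \<rho>. row_weight r \<le> real M) \<and>
      (\<forall>i\<ge>length \<rho>. (\<Sum>k\<in>F. \<bar>apply_bcontfun (g k) i\<bar>) \<le> C)}"
  define R where "R = {((\<rho>', F', N'), (\<rho>, F, N)) |\<rho>' F' N' \<rho> F N. (\<rho>', F', N') \<in> P \<and> (\<rho>, F, N) \<in> P \<and>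
      (\<exists>us. \<rho>' = \<rho> @ us) \<and> F \<subseteq> F' \<and> N \<le> N' \<and> (\<forall>i. length \<rho> \<le> i \<longrightarrow> i < length \<rho>' \<longrightarrow> fits F N (\<rho>' ! i) i)}"
  have R_iff: "((\<rho>', F', N'), (\<rho>, F, N)) \<in> R \<longleftrightarrow> (\<rho>', F', N') \<in> P \<and> (\<rho>, F, N) \<in> P \<and>
      (\<exists>us. \<rho>' = \<rho> @ us) \<and> F \<subseteq> F' \<and> N \<le> N' \<and> (\<forall>i. length \<rho> \<le> i \<longrightarrow> i < length \<rho>' \<longrightarrow> fits F N (\<rho>' ! i) i)"
    for \<rho>' F' N' \<rho> F N by (simp add: R_def)
  have extend: "\<exists>us. length (\<rho> @ us) = m \<and> (\<forall>r\<in>set us. row_weight r \<le> real M) \<and>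
      (\<forall>i. length \<rho> \<le> i \<longrightarrow> i < m \<longrightarrow> fits E N ((\<rho> @ us) ! i) i)"
    if E: "finite E" "\<And>i. i \<ge> length \<rho> \<Longrightarrow> (\<Sum>k\<in>E. \<bar>apply_bcontfun (g k) i\<bar>) \<le> 2 * C" and m: "length \<rho> \<le> m"
    for E N m and \<rho> :: "row list"
  proof -
    have "\<forall>i. \<exists>r. length \<rho> \<le> i \<longrightarrow> row_weight r \<le> real M \<and> fits E N r i"
    proof
      fix i
      show "\<exists>r. length \<rho> \<le> i \<longrightarrow> row_weight r \<le> real M \<and> fits E N r i"
      proof (cases "length \<rho> \<le> i")
        case True
        show ?thesis
          using row_approx[OF J f c E(1) E(2)[OF True] M, of "1 / real (Suc N)" N] by (auto simp: fits_def)
      qed simp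
    qed
    then obtain s where s: "\<And>i. length \<rho> \<le> i \<Longrightarrow> row_weight (s i) \<le> real M \<and> fits E N (s i) i" by metis
    show ?thesis
    proof (intro exI[of _ "map s [length \<rho>..<m]"] conjI allI impI ballI)
      show "length (\<rho> @ map s [length \<rho>..<m]) = m" using m by simp
      show "row_weight r \<le> real M" if "r \<in> set (map s [length \<rho>..<m])" for r using that s by auto
      show "fits E N ((\<rho> @ map s [length \<rho>..<m]) ! i) i" if "length \<rho> \<le> i" "i < m" for i
        using that s[of i] by (simp add: nth_append)
    qed
  qed
  \<comment> \<open>The added rows obey the promise \<open>(E, N)\<close>, and enough of them are
    added for the sums over \<open>E'\<close> to fall below \<open>C\<close>. From then on
    \<open>E'\<close> can be promised, with any \<open>N'\<close>.\<close>
  have extend_P: "\<exists>us. (\<rho> @ us, E', N') \<in> P \<and> m \<le> length (\<rho> @ us) \<and>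
      (\<forall>i. length \<rho> \<le> i \<longrightarrow> i < length (\<rho> @ us) \<longrightarrow> fits E N ((\<rho> @ us) ! i) i)"
    if E: "finite E" "\<And>i. i \<ge> length \<rho> \<Longrightarrow> (\<Sum>k\<in>E. \<bar>apply_bcontfun (g k) i\<bar>) \<le> 2 * C" and E': "finite E'"
      and \<rho>: "\<forall>r\<in>set \<rho>. row_weight r \<le> real M" for E E' N N' m \<rho>
  proof -
    obtain l where l: "\<And>i. i \<ge> l \<Longrightarrow> (\<Sum>k\<in>E'. \<bar>apply_bcontfun (g k) i\<bar>) \<le> C"
      using C(2)[OF E'] unfolding eventually_sequentially by blast
    obtain us where us: "length (\<rho> @ us) = max (length \<rho>) (max l m)" "\<forall>r\<in>set us. row_weight r \<le> real M"
      "\<forall>i. length \<rho> \<le> i \<longrightarrow> i < max (length \<rho>) (max l m) \<longrightarrow> fits E N ((\<rho> @ us) ! i) i"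
      using extend[OF E, of \<rho> "max (length \<rho>) (max l m)" N] by auto
    have "(\<rho> @ us, E', N') \<in> P" unfolding P_def using E' \<rho> us(2) l us(1) by auto
    then show ?thesis using us by (intro exI[of _ us]) simp
  qed
  have "partial_order_on P R"
    unfolding partial_order_on_def preorder_on_def
  proof (intro conjI)
    show "R \<subseteq> P \<times> P" by (auto simp: R_def)
    show "refl_on P R" unfolding refl_on_def by (auto simp: R_iff)
    show "antisym R" by (rule antisymI) (auto simp: R_def)
    show "trans R"
    proof (rule transI)
      fix x y z assume xy: "(x, y) \<in> R" and yz: "(y, z) \<in> R"
      obtain \<rho>x Fx Nx \<rho>y Fy Ny \<rho>z Fz Nz where xyz: "x = (\<rho>x, Fx, Nx)" "y = (\<rho>y, Fy, Ny)" "z = (\<rho>z, Fz, Nz)"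
        by (metis prod_cases3)
      have "fits Fz Nz (\<rho>x ! i) i" if i: "length \<rho>z \<le> i" "i < length \<rho>x" for i
      proof (cases "i < length \<rho>y")
        case True
        then have "\<rho>x ! i = \<rho>y ! i" using xy by (auto simp: xyz R_iff nth_append)
        then show ?thesis using yz True i by (auto simp: xyz R_iff)
      next
        case False
        then have "fits Fy Ny (\<rho>x ! i) i" using xy i by (auto simp: xyz R_iff)
        then show ?thesis using yz fits_mono by (auto simp: xyz R_iff)
      qed
      then show "(x, z) \<in> R" using xy yz by (auto simp: xyz R_iff)
    qed
  qed
  moreover have "sigma_linked P R" unfolding sigma_linked_def
  proof (intro exI[of _ "\<lambda>n. {(\<rho>, F, N). (\<rho>, F, N) \<in> P \<and> to_nat (\<rho>, N) = n}"] conjI allI ballI)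
    show "P = (\<Union>n. {(\<rho>, F, N). (\<rho>, F, N) \<in> P \<and> to_nat (\<rho>, N) = n})" by auto
    fix n p q
    assume p: "p \<in> {(\<rho>, F, N). (\<rho>, F, N) \<in> P \<and> to_nat (\<rho>, N) = n}"
      and q: "q \<in> {(\<rho>, F, N). (\<rho>, F, N) \<in> P \<and> to_nat (\<rho>, N) = n}"
    obtain \<rho> F N where p': "p = (\<rho>, F, N)" "(\<rho>, F, N) \<in> P" "to_nat (\<rho>, N) = n" using p by auto
    obtain \<sigma> F' N' where q': "q = (\<sigma>, F', N')" "(\<sigma>, F', N') \<in> P" "to_nat (\<sigma>, N') = n" using q by auto
    have eq: "\<sigma> = \<rho>" "N' = N" using p'(3) q'(3) by (metis inj_to_nat injD prod.inject)+
    have fin: "finite (F \<union> F')" using p'(2) q'(2) by (auto simp: P_def)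
    have "(\<Sum>k\<in>F \<union> F'. \<bar>apply_bcontfun (g k) i\<bar>) \<le> 2 * C" if "length \<rho> \<le> i" for i
    proof -
      have "(\<Sum>k\<in>F \<union> F'. \<bar>apply_bcontfun (g k) i\<bar>)
          \<le> (\<Sum>k\<in>F. \<bar>apply_bcontfun (g k) i\<bar>) + (\<Sum>k\<in>F'. \<bar>apply_bcontfun (g k) i\<bar>)"
        using fin by (subst sum.union_inter[symmetric]) (auto intro: sum_nonneg)
      also have "\<dots> \<le> C + C" using p'(2) q'(2) that eq by (intro add_mono) (auto simp: P_def)
      finally show ?thesis by simp
    qed
    moreover have "\<forall>r\<in>set \<rho>. row_weight r \<le> real M" using p'(2) by (auto simp: P_def)
    ultimately obtain us where us: "(\<rho> @ us, F \<union> F', N) \<in> P"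
      "\<And>i. length \<rho> \<le> i \<Longrightarrow> i < length (\<rho> @ us) \<Longrightarrow> fits (F \<union> F') N ((\<rho> @ us) ! i) i"
      using extend_P[OF fin _ fin, of \<rho> N 0 N] by blast
    have "fits F N ((\<rho> @ us) ! i) i" "fits F' N ((\<rho> @ us) ! i) i" if "length \<rho> \<le> i" "i < length (\<rho> @ us)" for i
      by (rule fits_mono[OF us(2)[OF that]]; simp)+
    then have "((\<rho> @ us, F \<union> F', N), p) \<in> R" "((\<rho> @ us, F \<union> F', N), q) \<in> R"
      using us(1) p' q' unfolding eq by (auto simp: R_iff)
    then show "compatible_in P R p q" using us(1) unfolding compatible_in_def by blast
  qed
  moreover
  \<comment> \<open>These sets put \<open>k\<close> under the promise, force accuracy
    \<open>1 / (n + 1)\<close> and support beyond \<open>n\<close>, and make the matrix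
    grow.\<close>
  define D where "D = (\<lambda>(k, n). {(\<rho>, F, N). (\<rho>, F, N) \<in> P \<and> k \<in> F \<and> n \<le> N \<and> n \<le> length \<rho>})"
  have "order_dense P R (D i)" for i
    unfolding order_dense_def
  proof (intro conjI ballI)
    obtain k n where i: "i = (k, n)" by (cases i)
    show "D i \<subseteq> P" by (auto simp: D_def i)
    fix p assume "p \<in> P"
    moreover obtain \<rho> F N where p: "p = (\<rho>, F, N)" by (metis prod_cases3)
    ultimately have pP: "(\<rho>, F, N) \<in> P" by simp
    then have F: "finite F" "\<And>i. length \<rho> \<le> i \<Longrightarrow> (\<Sum>k\<in>F. \<bar>apply_bcontfun (g k) i\<bar>) \<le> 2 * C"
      and w: "\<forall>r\<in>set \<rho>. row_weight r \<le> real M"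
      using C(1) by (fastforce simp: P_def)+
    obtain us where "(\<rho> @ us, insert k F, max n N) \<in> P" "n \<le> length (\<rho> @ us)"
      "\<forall>i. length \<rho> \<le> i \<longrightarrow> i < length (\<rho> @ us) \<longrightarrow> fits F N ((\<rho> @ us) ! i) i"
      using extend_P[OF F _ w, of "insert k F" "max n N" n N] F(1) by auto
    then show "\<exists>d\<in>D i. (d, p) \<in> R" using pP
      by (intro bexI[of _ "(\<rho> @ us, insert k F, max n N)"]) (auto simp: R_iff p D_def i)
  qed
  moreover have "|UNIV :: ('k \<times> nat) set| \<le>o |UNIV :: 'k set|"
    by (intro card_of_prod_ordLeq card_of_countable_ordLeq inf) (rule card_of_mono1, simp)
  moreover have "([], {}, 0) \<in> P" using C(1) by (simp add: P_def)
  then have "P \<noteq> {}" by blast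
  ultimately obtain G where G: "order_filter P R G" and GD: "\<And>i. G \<inter> D i \<noteq> {}"
    using MA_sigma_linked_filter[OF inf MA, of P R D] by blast
  have meet: "\<exists>\<rho> F N. (\<rho>, F, N) \<in> G \<and> k \<in> F \<and> n \<le> N \<and> n \<le> length \<rho>" for k n
    using GD[of "(k, n)"] by (auto simp: D_def)
  \<comment> \<open>Only the length matters here, so \<open>undefined\<close> stands for an
    arbitrary index \<open>k\<close>.\<close>
  have "\<exists>\<sigma>. i < length \<sigma> \<and> (\<exists>F N. (\<sigma>, F, N) \<in> G)" for i
    using meet[of undefined "Suc i"] by (auto simp: Suc_le_eq)
  then obtain \<sigma> where \<sigma>: "\<And>i. i < length (\<sigma> i)" "\<And>i. \<exists>F N. (\<sigma> i, F, N) \<in> G" by metis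
  define \<rho> where "\<rho> i = \<sigma> i ! i" for i
  have weight: "row_weight (\<rho> i) \<le> real M" for i
  proof -
    obtain F N where "(\<sigma> i, F, N) \<in> P" using \<sigma>(2)[of i] G unfolding order_filter_def by blast
    then show ?thesis using \<sigma>(1)[of i] by (auto simp: P_def \<rho>_def)
  qed
  \<comment> \<open>A common extension of \<open>(\<tau>, F, N)\<close> and of the condition that
    supplied row \<open>i\<close> contains that very row, and being below
    \<open>(\<tau>, F, N)\<close> it keeps its promise.\<close>
  have fits_\<rho>: "fits F N (\<rho> i) i" if \<tau>: "(\<tau>, F, N) \<in> G" and i: "length \<tau> \<le> i" for \<tau> F N i
  proof -
    obtain E L where "(\<sigma> i, E, L) \<in> G" using \<sigma>(2) by blast
    then obtain s where s: "s \<in> G" "(s, (\<tau>, F, N)) \<in> R" "(s, (\<sigma> i, E, L)) \<in> R"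
      using order_filter_directed[OF G _ \<tau>] order_filter_directed[OF G \<tau>] by blast
    obtain \<upsilon> E' L' where s': "s = (\<upsilon>, E', L')" by (metis prod_cases3)
    obtain us where us: "\<upsilon> = \<sigma> i @ us" using s(3) by (auto simp: s' R_iff)
    have "\<upsilon> ! i = \<rho> i" "i < length \<upsilon>" using \<sigma>(1)[of i] by (auto simp: us \<rho>_def nth_append)
    then show ?thesis using s(2) i unfolding s' R_iff by metis
  qed
  have adm: "admissible \<rho>"
    unfolding admissible_def
  proof (intro conjI allI exI)
    show "row_weight (\<rho> i) \<le> real M" for i by (rule weight)
    fix n
    obtain \<tau> F N where "(\<tau>, F, N) \<in> G" "n \<le> N" using meet by blast
    then have "\<forall>i\<ge>length \<tau>. \<forall>x\<in>set (\<rho> i). n \<le> fst x" using fits_\<rho> unfolding fits_def by fastforce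
    then show "\<forall>\<^sub>F i in sequentially. \<forall>x\<in>set (\<rho> i). n \<le> fst x" unfolding eventually_sequentially by blast
  qed
  have "matrix_op \<rho> (J (c0_unit k)) = K (c0_unit k)" for k
  proof -
    obtain h :: linf where h: "apply_bcontfun h = (\<lambda>i. row_val (\<rho> i) (apply_bcontfun (f k)))"
      using ex_rows[of \<rho> "real M" "f k"] weight by blast
    have "(\<lambda>i. apply_bcontfun h i - apply_bcontfun (g k) i) \<longlonglongrightarrow> 0"
    proof (rule LIMSEQ_I)
      fix e :: real assume "0 < e"
      then obtain n where n: "1 / real (Suc n) < e" using nat_approx_posE by blast
      obtain \<tau> F N where \<tau>: "(\<tau>, F, N) \<in> G" "k \<in> F" "n \<le> N" using meet by blast
      have "norm (apply_bcontfun h i - apply_bcontfun (g k) i - 0) < e" if "length \<tau> \<le> i" for i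
      proof -
        have "fits {k} n (\<rho> i) i" by (rule fits_mono[OF fits_\<rho>[OF \<tau>(1) that]]) (use \<tau> in auto)
        then show ?thesis using n by (simp add: fits_def h)
      qed
      then show "\<exists>no. \<forall>i\<ge>no. norm (apply_bcontfun h i - apply_bcontfun (g k) i - 0) < e" by blast
    qed
    then show ?thesis by (simp add: f g matrix_op_class[OF adm h] abs_linf_mod_c0_eq_iff)
  qed
  then have "matrix_op \<rho> (J v) = K v" for v
    by (rule bounded_linear_c0_eqI[OF bounded_linear_compose[OF bounded_linear_matrix_op[OF adm] J] K])
  then show ?thesis using bounded_linear_matrix_op[OF adm] by blast
qed

section \<open>Automorphisms\<close>

definition bounded_below :: "('a::real_normed_vector \<Rightarrow> 'b::real_normed_vector) \<Rightarrow> bool"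
  where "bounded_below J \<longleftrightarrow> (\<exists>c>0. \<forall>v. c * norm v \<le> norm (J v))"

text \<open>A bounded inverse is demanded outright, so that compositions and inverses are immediate;
  \<open>automorphism_isomorphism_on\<close> leads back to homeomorphisms.\<close>

definition automorphism :: "('a::real_normed_vector \<Rightarrow> 'a) \<Rightarrow> bool"
  where "automorphism T \<longleftrightarrow> bounded_linear T \<and> (\<exists>S. bounded_linear S \<and> (\<forall>x. S (T x) = x) \<and> (\<forall>x. T (S x) = x))"

lemma automorphism_bounded_linear: "automorphism T \<Longrightarrow> bounded_linear T"
  by (simp add: automorphism_def)

lemma automorphism_compose:
  assumes "automorphism T" "automorphism S"
  shows "automorphism (\<lambda>x. T (S x))"
proof -
  obtain T' S' where T': "bounded_linear T'" "\<forall>x. T' (T x) = x" "\<forall>x. T (T' x) = x"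
    and S': "bounded_linear S'" "\<forall>x. S' (S x) = x" "\<forall>x. S (S' x) = x"
    using assms unfolding automorphism_def by metis
  show ?thesis unfolding automorphism_def
  proof (intro conjI exI[of _ "\<lambda>x. S' (T' x)"] allI)
    show "bounded_linear (\<lambda>x. T (S x))"
      by (rule bounded_linear_compose[OF assms[THEN automorphism_bounded_linear]])
    show "bounded_linear (\<lambda>x. S' (T' x))" by (rule bounded_linear_compose[OF S'(1) T'(1)])
  qed (simp_all add: T' S')
qed

lemma automorphism_inverse:
  assumes "automorphism T"
  shows "\<exists>S. automorphism S \<and> (\<forall>x. S (T x) = x)"
  using assms unfolding automorphism_def by metis

text \<open>The inverse is \<open>1 - N\<close>, since the product of the two is
  \<open>1 - N\<^sup>2\<close>.\<close>

lemma automorphism_add_square_zero: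
  assumes "bounded_linear N" "\<And>x. N (N x) = 0"
  shows "automorphism (\<lambda>x. x + N x)"
proof -
  interpret N: bounded_linear N by fact
  show ?thesis unfolding automorphism_def
  proof (intro conjI exI[of _ "\<lambda>x. x - N x"] allI)
    show "bounded_linear (\<lambda>x. x + N x)" "bounded_linear (\<lambda>x. x - N x)"
      by (intro bounded_linear_add bounded_linear_sub bounded_linear_ident assms)+
  qed (simp_all add: N.add N.diff assms(2))
qed

section \<open>Embeddings and operators on subspaces\<close>

lemma bounded_below_of_compose:
  assumes "operator_on W S" "\<And>v. J v \<in> W" "bounded_below (\<lambda>v. S (J v))"
  shows "bounded_below J"
proof -
  obtain C where C: "\<And>y. y \<in> W \<Longrightarrow> norm (S y) \<le> C * norm y" using assms(1) unfolding operator_on_def by blast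
  obtain c where c: "0 < c" "\<And>v. c * norm v \<le> norm (S (J v))" using assms(3) unfolding bounded_below_def by blast
  have "c / (\<bar>C\<bar> + 1) * norm v \<le> norm (J v)" for v
  proof -
    have "c * norm v \<le> C * norm (J v)" using c(2) C[OF assms(2)] order_trans by blast
    also have "\<dots> \<le> (\<bar>C\<bar> + 1) * norm (J v)" by (intro mult_right_mono) auto
    finally show ?thesis by (simp add: field_simps)
  qed
  then show ?thesis using c(1) unfolding bounded_below_def by (intro exI[of _ "c / (\<bar>C\<bar> + 1)"]) simp
qed

lemma bounded_below_automorphism:
  assumes "automorphism T" "bounded_below J"
  shows "bounded_below (\<lambda>v. T (J v))"
proof -
  obtain S where S: "bounded_linear S" "\<And>x. S (T x) = x"
    using assms(1) unfolding automorphism_def by blast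
  then have "operator_on UNIV S" by (simp add: operator_on_UNIV)
  then show ?thesis by (rule bounded_below_of_compose) (simp_all add: S(2) assms(2))
qed

lemma operator_on_compose:
  assumes "operator_on Z T" "bounded_linear J" "\<And>v. J v \<in> Z"
  shows "bounded_linear (\<lambda>v. T (J v))"
proof -
  interpret J: bounded_linear J by fact
  obtain C where C: "\<And>x. x \<in> Z \<Longrightarrow> norm (T x) \<le> C * norm x" and lin: "linear_on Z T"
    using assms(1) unfolding operator_on_def by blast
  obtain B where B: "\<And>v. norm (J v) \<le> norm v * B" using J.bounded by blast
  show ?thesis
  proof (rule bounded_linear_intro[of _ "B * \<bar>C\<bar>"])
    fix u v c
    show "T (J (u + v)) = T (J u) + T (J v)" "T (J (c *\<^sub>R v)) = c *\<^sub>R T (J v)"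
      using lin assms(3) by (simp_all add: linear_on_def J.add J.scaleR)
    have "norm (T (J v)) \<le> C * norm (J v)" by (rule C[OF assms(3)])
    also have "\<dots> \<le> \<bar>C\<bar> * (norm v * B)" by (intro mult_mono B) auto
    finally show "norm (T (J v)) \<le> norm v * (B * \<bar>C\<bar>)" by (simp add: mult_ac)
  qed
qed

text \<open>Isomorphisms are given as homeomorphisms, so norm bounds have to be extracted from
  continuity at 0 by scaling a vector into a small ball.\<close>

lemma linear_on_continuous_operator_on:
  assumes Z: "subspace Z" and T: "linear_on Z T" "continuous_on Z T"
  shows "operator_on Z T"
proof -
  have T0: "T 0 = 0" using T(1) subspace_0[OF Z] unfolding linear_on_def by (metis scale_zero_left)
  obtain d where d: "0 < d" "\<And>x. x \<in> Z \<Longrightarrow> norm x < d \<Longrightarrow> norm (T x) < 1"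
    using T(2)[unfolded continuous_on_iff, rule_format, of 0 1] subspace_0[OF Z]
    by (auto simp: T0 dist_norm)
  have "norm (T x) \<le> 2 / d * norm x" if x: "x \<in> Z" for x
  proof (cases "x = 0")
    case False
    define t where "t = d / (2 * norm x)"
    have t: "0 < t" "t * norm x < d" using d(1) False by (auto simp: t_def)
    then have "norm (T (t *\<^sub>R x)) < 1" by (intro d(2) subspace_scale[OF Z x]) simp
    moreover have "T (t *\<^sub>R x) = t *\<^sub>R T x" using T(1) x by (simp add: linear_on_def)
    ultimately have "t * norm (T x) < 1" using t(1) by simp
    then show ?thesis using d(1) False by (simp add: t_def field_simps)
  qed (simp add: T0)
  then show ?thesis using T(1) unfolding operator_on_def by blast
qed

lemma isomorphism_on_inverse:
  assumes Z: "subspace Z" and W: "subspace W" and T: "isomorphism_on Z W T"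
  obtains S where "operator_on Z T" "operator_on W S" "\<And>x. x \<in> Z \<Longrightarrow> T x \<in> W \<and> S (T x) = x"
    "\<And>y. y \<in> W \<Longrightarrow> S y \<in> Z \<and> T (S y) = y"
proof -
  obtain S where lin: "linear_on Z T" and S: "homeomorphism Z W T S"
    using T unfolding isomorphism_on_def by blast
  have ST: "T x \<in> W \<and> S (T x) = x" if "x \<in> Z" for x using S that unfolding homeomorphism_def by blast
  have TS: "S y \<in> Z \<and> T (S y) = y" if "y \<in> W" for y using S that unfolding homeomorphism_def by blast
  have "linear_on W S" unfolding linear_on_def
  proof (intro conjI ballI allI)
    fix x y c assume x: "x \<in> W"
    show "S (x + y) = S x + S y" if y: "y \<in> W"
    proof -
      have "T (S x + S y) = x + y" using lin TS[OF x] TS[OF y] by (simp add: linear_on_def)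
      then show ?thesis using ST[of "S x + S y"] subspace_add[OF Z] TS x y by metis
    qed
    show "S (c *\<^sub>R x) = c *\<^sub>R S x"
    proof -
      have "T (c *\<^sub>R S x) = c *\<^sub>R x" using lin TS[OF x] by (simp add: linear_on_def)
      then show ?thesis using ST[of "c *\<^sub>R S x"] subspace_scale[OF Z] TS x by metis
    qed
  qed
  then have "operator_on W S" "operator_on Z T"
    using linear_on_continuous_operator_on[OF W _ homeomorphism_cont2[OF S]]
      linear_on_continuous_operator_on[OF Z lin homeomorphism_cont1[OF S]] by simp_all
  then show thesis using that ST TS by blast
qed

lemma isomorphic_to_embedding:
  fixes Z :: "'x::real_normed_vector set"
  assumes "isomorphic_to Z TYPE('y::real_normed_vector)" "subspace Z"
  obtains J :: "'y::real_normed_vector \<Rightarrow> 'x" where "bounded_linear J" "bounded_below J" "range J = Z"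
proof -
  obtain J :: "'y \<Rightarrow> 'x" where "isomorphism_on UNIV Z J" using assms(1) unfolding isomorphic_to_def by blast
  then obtain S where J: "operator_on UNIV J" and S: "operator_on Z S"
    and JS: "\<And>v. J v \<in> Z" "\<And>v. S (J v) = v" and SJ: "\<And>z. z \<in> Z \<Longrightarrow> J (S z) = z"
    using isomorphism_on_inverse[OF subspace_UNIV assms(2)] by (metis UNIV_I)
  have "bounded_below (\<lambda>v. S (J v))" using JS unfolding bounded_below_def by (intro exI[of _ 1]) simp
  then have "bounded_below J" by (rule bounded_below_of_compose[OF S, of J, rotated]) (simp add: JS)
  moreover have "range J = Z" using JS SJ by (metis image_eqI rangeE subsetI subset_antisym UNIV_I)
  ultimately show thesis using that J by (simp add: operator_on_UNIV)
qed

text \<open>With \<open>U (P\<^sub>A J v) = P\<^sub>-\<^sub>A J v\<close>, the automorphism \<open>1 - P\<^sub>-\<^sub>A U P\<^sub>A\<close> removes the part of \<open>J v\<close> outside \<open>A\<close>.\<close>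

lemma automorphism_into_half:
  fixes J :: "'k c0 \<Rightarrow> linf_mod_c0"
  assumes inf: "infinite (UNIV :: 'k set)" and MA: "MA_sigma_linked TYPE('k)"
    and J: "bounded_linear J" "bounded_below J"
  obtains A V where "infinite A" "infinite (- A)" "automorphism V" "\<And>v. restr_op (- A) (V (J v)) = 0"
proof -
  obtain c where c: "0 < c" "\<And>v. c * norm v \<le> norm (J v)" using J(2) unfolding bounded_below_def by blast
  obtain A where A: "infinite A" "infinite (- A)" "\<And>v. c / 2 * norm v \<le> norm (restr_op A (J v))"
    using splitting_set[OF inf MA J(1) c] by blast
  have rl: "bounded_linear (\<lambda>v. restr_op B (J v))" for B
    by (rule bounded_linear_compose[OF bounded_linear_restr_op J(1)])
  obtain U where U: "bounded_linear U" "\<And>v. U (restr_op A (J v)) = restr_op (- A) (J v)"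
    using operator_through_embedding[OF inf MA rl[of A] _ A(3) rl[of "- A"]] c(1) by auto
  \<comment> \<open>\<open>N\<close> reads only the part on \<open>A\<close> and writes only outside
    \<open>A\<close>, so \<open>N \<circ> N\<close> vanishes.\<close>
  define N where "N = (\<lambda>x. - restr_op (- A) (U (restr_op A x)))"
  have N: "bounded_linear N" unfolding N_def
    by (intro bounded_linear_minus bounded_linear_compose[OF bounded_linear_restr_op]
        bounded_linear_compose[OF U(1)] bounded_linear_restr_op)
  interpret R: bounded_linear "restr_op B" for B by (rule bounded_linear_restr_op)
  interpret U: bounded_linear U by fact
  have "N (N x) = 0" for x
    by (simp add: N_def R.neg restr_op_restr_op restr_op_empty U.zero R.zero)
  then have "automorphism (\<lambda>x. x + N x)" by (rule automorphism_add_square_zero[OF N])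
  moreover have "restr_op (- A) (J v + N (J v)) = 0" for v
    by (simp add: N_def U(2) R.diff restr_op_restr_op)
  ultimately show thesis using that[OF A(1,2)] by blast
qed

section \<open>Moving one embedding onto another\<close>

lemma bij_mapping_onto_half:
  assumes "infinite (A :: nat set)" "infinite (- A)" "infinite (B :: nat set)" "infinite (- B)"
  obtains \<pi> where "bij \<pi>" "\<pi> -` A = B"
proof -
  have ex: "\<exists>p. bij_betw p S T" if "infinite S" "infinite T" for S T :: "nat set"
    using bij_betw_trans[OF bij_betw_inv_into[OF bij_enumerate[OF that(1)]] bij_enumerate[OF that(2)]] by blast
  obtain p q where p: "bij_betw p B A" and q: "bij_betw q (- B) (- A)" using ex assms by metis
  define \<pi> where "\<pi> i = (if i \<in> B then p i else q i)" for i
  have "bij_betw \<pi> B A = bij_betw p B A" "bij_betw \<pi> (- B) (- A) = bij_betw q (- B) (- A)"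
    by (rule bij_betw_cong, simp add: \<pi>_def)+
  then have "bij_betw \<pi> B A" "bij_betw \<pi> (- B) (- A)" using p q by simp_all
  then have "bij_betw \<pi> (B \<union> - B) (A \<union> - A)" by (rule bij_betw_combine) auto
  moreover have "\<pi> -` A = B" using bij_betwE[OF p] bij_betwE[OF q] by (auto simp: \<pi>_def split: if_splits)
  ultimately show thesis using that by (simp add: Un_commute)
qed

lemma automorphism_comp_op:
  assumes "bij \<pi>"
  shows "automorphism (comp_op \<pi>)"
proof -
  have "inj \<pi>" "inj (inv \<pi>)" using assms bij_is_inj bij_imp_bij_inv by auto
  moreover have "\<pi> (inv \<pi> i) = i" "inv \<pi> (\<pi> i) = i" for i
    using assms by (simp_all add: bij_is_surj surj_f_inv_f bij_is_inj inv_f_f)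
  ultimately show ?thesis unfolding automorphism_def
    by (intro conjI exI[of _ "comp_op (inv \<pi>)"] allI bounded_linear_comp_op comp_op_comp_op)
qed

lemma automorphism_between_embeddings:
  fixes J J' :: "'k c0 \<Rightarrow> linf_mod_c0"
  assumes inf: "infinite (UNIV :: 'k set)" and MA: "MA_sigma_linked TYPE('k)"
    and J: "bounded_linear J" "bounded_below J" and J': "bounded_linear J'" "bounded_below J'"
  shows "\<exists>T. automorphism T \<and> (\<forall>v. T (J v) = J' v)"
proof -
  interpret R: bounded_linear "restr_op B" for B by (rule bounded_linear_restr_op)
  obtain A V where A: "infinite A" "infinite (- A)" and V: "automorphism V" "\<And>v. restr_op (- A) (V (J v)) = 0"
    using automorphism_into_half[OF inf MA J] by blast
  obtain A' V' where A': "infinite A'" "infinite (- A')"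
    and V': "automorphism V'" "\<And>v. restr_op (- A') (V' (J' v)) = 0"
    using automorphism_into_half[OF inf MA J'] by blast
  \<comment> \<open>The complement of \<open>A\<close> is pulled back to \<open>A'\<close>, so
    \<open>J1\<close> will vanish on \<open>A'\<close> while \<open>J2\<close> vanishes off
    \<open>A'\<close>.\<close>
  obtain \<pi> where \<pi>: "bij \<pi>" "\<pi> -` (- A) = A'"
    using bij_mapping_onto_half[of "- A" A'] A A' by auto
  define J1 where "J1 = (\<lambda>v. comp_op \<pi> (V (J v)))"
  define J2 where "J2 = (\<lambda>v. V' (J' v))"
  have \<pi>V: "automorphism (\<lambda>x. comp_op \<pi> (V x))"
    by (rule automorphism_compose[OF automorphism_comp_op[OF \<pi>(1)] V(1)])
  have J1: "bounded_linear J1" "bounded_below J1"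
    unfolding J1_def
    by (rule bounded_linear_compose[OF automorphism_bounded_linear[OF \<pi>V] J(1)],
        rule bounded_below_automorphism[OF \<pi>V J(2)])
  have J2: "bounded_linear J2" "bounded_below J2"
    unfolding J2_def
    by (rule bounded_linear_compose[OF automorphism_bounded_linear[OF V'(1)] J'(1)],
        rule bounded_below_automorphism[OF V'(1) J'(2)])
  interpret P: bounded_linear "comp_op \<pi>" by (rule bounded_linear_comp_op) (rule bij_is_inj[OF \<pi>(1)])
  have "restr_op A' (J1 v) = 0" for v
    using comp_op_restr_op[OF bij_is_inj[OF \<pi>(1)], of "- A" "V (J v)"] by (simp add: J1_def V(2) \<pi>(2) P.zero)
  then have r1: "restr_op A' (J1 v) = 0" "restr_op (- A') (J1 v) = J1 v" for v
    using restr_op_Compl[of A' "J1 v"] by simp_all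
  have r2: "restr_op (- A') (J2 v) = 0" "restr_op A' (J2 v) = J2 v" for v
    using restr_op_Compl[of A' "J2 v"] V'(2)[of v] by (simp_all add: J2_def)
  obtain U where U: "bounded_linear U" "\<And>v. U (J1 v) = J2 v"
    using operator_through_embedding[OF inf MA J1(1) _ _ J2(1)] J1(2) unfolding bounded_below_def by blast
  obtain W where W: "bounded_linear W" "\<And>v. W (J2 v) = J1 v"
    using operator_through_embedding[OF inf MA J2(1) _ _ J1(1)] J2(2) unfolding bounded_below_def by blast
  interpret U: bounded_linear U by fact
  interpret W: bounded_linear W by fact
  \<comment> \<open>The two shears act as \<open>J1 v\<close>, then \<open>J1 v + J2 v\<close>, then
    \<open>J2 v\<close>: the first adds the copy made by \<open>U\<close>, the second recovers
    \<open>J1 v\<close> from \<open>J2 v\<close> by \<open>W\<close> and subtracts it.\<close>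
  define N1 where "N1 = (\<lambda>x. restr_op A' (U (restr_op (- A') x)))"
  define N2 where "N2 = (\<lambda>x. - restr_op (- A') (W (restr_op A' x)))"
  have bN: "bounded_linear N1" "bounded_linear N2" unfolding N1_def N2_def
    by (intro bounded_linear_minus bounded_linear_compose[OF bounded_linear_restr_op]
        bounded_linear_compose[OF U(1)] bounded_linear_compose[OF W(1)] bounded_linear_restr_op)+
  have "N1 (N1 x) = 0" "N2 (N2 x) = 0" for x
    by (simp_all add: N1_def N2_def R.neg restr_op_restr_op restr_op_empty U.zero W.zero R.zero)
  then have aut: "automorphism (\<lambda>x. x + N1 x)" "automorphism (\<lambda>x. x + N2 x)"
    using bN by (auto intro: automorphism_add_square_zero)
  have step1: "J1 v + N1 (J1 v) = J1 v + J2 v" for v by (simp add: N1_def r1 r2 U(2))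
  have step2: "(J1 v + J2 v) + N2 (J1 v + J2 v) = J2 v" for v
    by (simp add: N2_def R.add r1 r2 W(2))
  obtain V'' where V'': "automorphism V''" "\<And>x. V'' (V' x) = x" using automorphism_inverse[OF V'(1)] by blast
  define T where "T = (\<lambda>x. V'' ((comp_op \<pi> (V x) + N1 (comp_op \<pi> (V x))) + N2 (comp_op \<pi> (V x) + N1 (comp_op \<pi> (V x)))))"
  have "automorphism T" unfolding T_def
    by (rule automorphism_compose[OF V''(1) automorphism_compose[OF aut(2) automorphism_compose[OF aut(1) \<pi>V]]])
  moreover have "T (J v) = J' v" for v
  proof -
    have "T (J v) = V'' ((J1 v + N1 (J1 v)) + N2 (J1 v + N1 (J1 v)))" by (simp add: T_def J1_def)
    also have "\<dots> = V'' (J2 v)" by (simp only: step1 step2)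
    finally show ?thesis by (simp add: J2_def V''(2))
  qed
  ultimately show ?thesis by blast
qed

lemma automorphism_isomorphism_on:
  assumes "automorphism T"
  shows "isomorphism_on UNIV UNIV T"
proof -
  obtain S where S: "bounded_linear S" "\<And>x. S (T x) = x" "\<And>x. T (S x) = x" and T: "bounded_linear T"
    using assms unfolding automorphism_def by blast
  have "homeomorphism UNIV UNIV T S"
    by (rule homeomorphismI) (use S T linear_continuous_on in auto)
  moreover have "linear_on UNIV T" using T by (simp flip: operator_on_UNIV add: operator_on_def)
  ultimately show ?thesis unfolding isomorphism_on_def by blast
qed

theorem theorem1p3:
  assumes "infinite (UNIV :: 'k set)"
    and "MA_sigma_linked TYPE('k)"
  shows "automorphic TYPE('k c0) TYPE(linf_mod_c0) \<and> extensible TYPE('k c0) TYPE(linf_mod_c0)"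
proof
  show "automorphic TYPE('k c0) TYPE(linf_mod_c0)"
    unfolding automorphic_def
  proof (intro allI impI, elim conjE)
    fix Z Z' :: "linf_mod_c0 set" and T
    assume Z: "subspace Z" "isomorphic_to Z TYPE('k c0)" and Z': "subspace Z'" and T: "isomorphism_on Z Z' T"
    obtain J :: "'k c0 \<Rightarrow> linf_mod_c0" where J: "bounded_linear J" "bounded_below J" "range J = Z"
      using isomorphic_to_embedding[OF Z(2,1)] by blast
    obtain S where op: "operator_on Z T" "operator_on Z' S"
      and ST: "\<And>x. x \<in> Z \<Longrightarrow> T x \<in> Z' \<and> S (T x) = x"
      using isomorphism_on_inverse[OF Z(1) Z' T] by metis
    have JZ: "J v \<in> Z" for v using J(3) by blast
    \<comment> \<open>The inverse \<open>S\<close> of \<open>T\<close> recovers \<open>J v\<close>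
      from \<open>T (J v)\<close>. So \<open>J\<close> and \<open>T \<circ> J\<close> are two
      embeddings, and an automorphism carrying the first to the second extends
      \<open>T\<close>.\<close>
    have "bounded_below (\<lambda>v. T (J v))"
      by (rule bounded_below_of_compose[OF op(2)]) (use ST JZ J(2) in simp_all)
    then obtain T' where "automorphism T'" "\<And>v. T' (J v) = T (J v)"
      using automorphism_between_embeddings[OF assms J(1,2) operator_on_compose[OF op(1) J(1) JZ]] by blast
    then show "\<exists>T'. isomorphism_on UNIV UNIV T' \<and> (\<forall>z\<in>Z. T' z = T z)"
      using automorphism_isomorphism_on J(3) by blast
  qed
  \<comment> \<open>Here \<open>T \<circ> J\<close> need not be bounded below; it is factored
    through \<open>J\<close> directly, without passing through automorphisms.\<close>
  show "extensible TYPE('k c0) TYPE(linf_mod_c0)"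
    unfolding extensible_def
  proof (intro allI impI, elim conjE)
    fix Z :: "linf_mod_c0 set" and T :: "linf_mod_c0 \<Rightarrow> linf_mod_c0"
    assume Z: "subspace Z" "isomorphic_to Z TYPE('k c0)" and T: "operator_on Z T"
    obtain J :: "'k c0 \<Rightarrow> linf_mod_c0" where J: "bounded_linear J" "bounded_below J" "range J = Z"
      using isomorphic_to_embedding[OF Z(2,1)] by blast
    have JZ: "J v \<in> Z" for v using J(3) by blast
    obtain U where "bounded_linear U" "\<And>v. U (J v) = T (J v)"
      using operator_through_embedding[OF assms J(1) _ _ operator_on_compose[OF T J(1) JZ]] J(2)
      unfolding bounded_below_def by blast
    then show "\<exists>T'. bounded_linear T' \<and> (\<forall>z\<in>Z. T' z = T z)" using J(3) by blast
  qed
qed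

end
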